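(* Let $\mathscr O$ be a set of pairwise disjoint line-segment obstacles, $s$ a starting point, $l>0$ a maximum path length, and let $SPM(s)$ be the shortest path map of $s$. Let $\Psi^*$ be the set of circular ordinary regions, one for each ordinary region of $SPM(s)$ having a valid control point. Then the achievable region satisfies $$\mathscr R=\mathscr R^*_{map}(k)\ \cup\bigcup_{\mathscr R^*_{map}(o)\in\Psi^*}\mathscr R^*_{map}(o).$$
   Context: $\pi(p,p')$ is the shortest obstacle-avoiding path length; the achievable region is $\mathscr R=\{p:\pi(s,p)\le l\}$; $C(p,r)$ is the closed disk of center $p$, radius $r$. $SPM(s)$ is the decomposition of the free space into regions such that shortest paths from $s$ to any two points of the same region pass through the same sequence of obstacle endpoints; the last endpoint of this sequence is the control point of the region. The region containing $s$ is the kernel-region $\mathscr R_{map}(k)$; every other region is an ordinary region. A control point $e_c$ is valid if $\pi(s,e_c)<l$. The circular kernel-region is $\mathscr R^*_{map}(k)=\mathscr R_{map}(k)\cap C(s,l)$. For an ordinary region $\mathscr R_{map}(o)$ with valid control point $e_c$, its circular ordinary region is $\mathscr R^*_{map}(o)=\mathscr R_{map}(o)\cap C(e_c,l-\pi(s,e_c))$. *)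

theory Defs
  imports "HOL-Analysis.Analysis"
begin

type_synonym point = "real^2"

text \<open>A line-segment obstacle is given by its two endpoints. Two pairs \<open>(a, b)\<close> and \<open>(b, a)\<close>
  describe the same segment, so disjointness prevents both from being present.\<close>

definition segment_obstacles :: "(point \<times> point) set \<Rightarrow> bool" where
  "segment_obstacles Ob \<longleftrightarrow>
     finite Ob \<and> (\<forall>(a, b) \<in> Ob. a \<noteq> b) \<and> disjoint_family_on (\<lambda>(a, b). closed_segment a b) Ob"

definition obstacle_endpoints :: "(point \<times> point) set \<Rightarrow> point set" where
  "obstacle_endpoints Ob = fst ` Ob \<union> snd ` Ob"

text \<open>Shortest paths bend at obstacle endpoints, so the endpoints belong to the free space;
  \<open>open_segment a b\<close> is the segment without its two endpoints.\<close>

definition free_space :: "(point \<times> point) set \<Rightarrow> point set" where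
  "free_space Ob = - (\<Union>(a, b) \<in> Ob. open_segment a b)"

text \<open>A path must not cross an obstacle, but it may run along one. This is expressed by allowing
  a path to enter and leave an obstacle only at its endpoints: the set of times at which the path
  is strictly inside the segment is relatively open in the parameter interval. In particular every
  path inside the free space is allowed. Forbidding paths along obstacles altogether would only
  destroy the existence of a shortest path (the infimum of the lengths would be the same) when an
  obstacle is collinear with the preceding point of the path.\<close>

definition obstacle_avoiding :: "(point \<times> point) set \<Rightarrow> (real \<Rightarrow> point) \<Rightarrow> bool" where
  "obstacle_avoiding Ob g \<longleftrightarrow>
     path g \<and> pathstart g \<in> free_space Ob \<and> pathfinish g \<in> free_space Ob \<and>
     (\<forall>(a, b) \<in> Ob. openin (top_of_set {0..1}) {t \<in> {0..1}. g t \<in> open_segment a b})"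

definition path_length :: "(real \<Rightarrow> point) \<Rightarrow> ereal" where
  "path_length g =
     (SUP ts \<in> {ts. sorted ts \<and> set ts \<subseteq> {0..1}}.
        ereal (\<Sum>i < length ts - 1. dist (g (ts ! i)) (g (ts ! Suc i))))"

definition avoiding_paths :: "(point \<times> point) set \<Rightarrow> point \<Rightarrow> point \<Rightarrow> (real \<Rightarrow> point) set" where
  "avoiding_paths Ob p q = {g. obstacle_avoiding Ob g \<and> pathstart g = p \<and> pathfinish g = q}"

definition obstacle_dist :: "(point \<times> point) set \<Rightarrow> point \<Rightarrow> point \<Rightarrow> ereal" where
  "obstacle_dist Ob p q = (INF g \<in> avoiding_paths Ob p q. path_length g)"

definition shortest_path :: "(point \<times> point) set \<Rightarrow> point \<Rightarrow> point \<Rightarrow> (real \<Rightarrow> point) \<Rightarrow> bool" where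
  "shortest_path Ob p q g \<longleftrightarrow> g \<in> avoiding_paths Ob p q \<and> path_length g = obstacle_dist Ob p q"

definition achievable_region :: "(point \<times> point) set \<Rightarrow> point \<Rightarrow> real \<Rightarrow> point set" where
  "achievable_region Ob s l = {p. obstacle_dist Ob s p \<le> ereal l}"

text \<open>The start and the finish of the path are not counted among the endpoints it passes through,
  even if they are themselves obstacle endpoints.\<close>

definition passes_through :: "(point \<times> point) set \<Rightarrow> (real \<Rightarrow> point) \<Rightarrow> point list \<Rightarrow> bool" where
  "passes_through Ob g es \<longleftrightarrow>
     distinct es \<and>
     set es = obstacle_endpoints Ob \<inter> path_image g - {pathstart g, pathfinish g} \<and>
     (\<exists>ts. sorted_wrt (<) ts \<and> set ts \<subseteq> {0..1} \<and> es = map g ts)"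

text \<open>The shortest path map is the family of the nonempty regions \<open>spm_region Ob s es\<close>, indexed by
  the sequence \<open>es\<close> of obstacle endpoints common to the region. A point with several shortest paths
  through different sequences lies on the common boundary of the corresponding regions and belongs
  to each of them.\<close>

definition spm_region :: "(point \<times> point) set \<Rightarrow> point \<Rightarrow> point list \<Rightarrow> point set" where
  "spm_region Ob s es =
     {p \<in> free_space Ob. \<exists>g. shortest_path Ob s p g \<and> passes_through Ob g es}"

definition spm_sequences :: "(point \<times> point) set \<Rightarrow> point \<Rightarrow> point list set" where
  "spm_sequences Ob s = {es. spm_region Ob s es \<noteq> {}}"

definition kernel_sequence :: "(point \<times> point) set \<Rightarrow> point \<Rightarrow> point list" where
  "kernel_sequence Ob s = (THE es. s \<in> spm_region Ob s es)"

definition kernel_region :: "(point \<times> point) set \<Rightarrow> point \<Rightarrow> point set" where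
  "kernel_region Ob s = spm_region Ob s (kernel_sequence Ob s)"

definition ordinary_sequences :: "(point \<times> point) set \<Rightarrow> point \<Rightarrow> point list set" where
  "ordinary_sequences Ob s = spm_sequences Ob s - {kernel_sequence Ob s}"

definition control_point :: "point list \<Rightarrow> point" where
  "control_point es = last es"

definition valid_control_point :: "(point \<times> point) set \<Rightarrow> point \<Rightarrow> real \<Rightarrow> point \<Rightarrow> bool" where
  "valid_control_point Ob s l e \<longleftrightarrow> obstacle_dist Ob s e < ereal l"

definition circular_kernel_region :: "(point \<times> point) set \<Rightarrow> point \<Rightarrow> real \<Rightarrow> point set" where
  "circular_kernel_region Ob s l = kernel_region Ob s \<inter> cball s l"

definition circular_ordinary_region ::
    "(point \<times> point) set \<Rightarrow> point \<Rightarrow> real \<Rightarrow> point list \<Rightarrow> point set" where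
  "circular_ordinary_region Ob s l es =
     spm_region Ob s es \<inter>
     cball (control_point es) (l - real_of_ereal (obstacle_dist Ob s (control_point es)))"

definition circular_ordinary_regions ::
    "(point \<times> point) set \<Rightarrow> point \<Rightarrow> real \<Rightarrow> point set set" where
  "circular_ordinary_regions Ob s l =
     circular_ordinary_region Ob s l `
       {es \<in> ordinary_sequences Ob s. valid_control_point Ob s l (control_point es)}"

text \<open>Exactly one region contains the starting point, namely the one with the empty sequence, so
  \<open>kernel_sequence\<close> is well defined and every ordinary region has a control point.\<close>

lemma path_length_nonneg: "0 \<le> path_length g"
  unfolding path_length_def by (rule SUP_upper2[of "[]"]) auto

lemma path_length_const: "path_length (\<lambda>_. p) = 0"
proof (rule antisym)
  show "path_length (\<lambda>_. p) \<le> 0"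
    unfolding path_length_def by (rule SUP_least) simp
qed (rule path_length_nonneg)

lemma const_avoiding:
  assumes "s \<in> free_space Ob"
  shows "(\<lambda>_. s) \<in> avoiding_paths Ob s s"
proof -
  have "s \<notin> open_segment a b" if "(a, b) \<in> Ob" for a b
    using assms that by (auto simp: free_space_def)
  then show ?thesis
    using assms
    by (auto simp: avoiding_paths_def obstacle_avoiding_def path_def pathstart_def pathfinish_def)
qed

lemma obstacle_dist_self:
  assumes "s \<in> free_space Ob"
  shows "obstacle_dist Ob s s = 0"
proof (rule antisym)
  show "obstacle_dist Ob s s \<le> 0"
    unfolding obstacle_dist_def
    by (rule INF_lower2[OF const_avoiding[OF assms]]) (simp add: path_length_const)
  show "0 \<le> obstacle_dist Ob s s"
    unfolding obstacle_dist_def by (rule INF_greatest) (rule path_length_nonneg)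
qed

lemma dist_le_path_length:
  assumes "0 \<le> u" "u \<le> v" "v \<le> 1"
  shows "ereal (dist (g u) (g v)) \<le> path_length g"
  unfolding path_length_def by (rule SUP_upper2[of "[u, v]"]) (use assms in auto)

lemma start_in_spm_region_iff:
  assumes "s \<in> free_space Ob"
  shows "s \<in> spm_region Ob s es \<longleftrightarrow> es = []"
proof
  assume "es = []"
  moreover have "shortest_path Ob s s (\<lambda>_. s)"
    using const_avoiding[OF assms] obstacle_dist_self[OF assms]
    by (simp add: shortest_path_def path_length_const)
  moreover have "passes_through Ob (\<lambda>_. s) []"
    by (auto simp: passes_through_def path_image_def pathstart_def)
  ultimately show "s \<in> spm_region Ob s es"
    using assms unfolding spm_region_def by blast
next
  assume "s \<in> spm_region Ob s es"
  then obtain g where g: "shortest_path Ob s s g" "passes_through Ob g es"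
    by (auto simp: spm_region_def)
  have len: "path_length g = 0" and g0: "g 0 = s"
    using g(1) obstacle_dist_self[OF assms]
    by (auto simp: shortest_path_def avoiding_paths_def pathstart_def)
  have "g t = s" if "t \<in> {0..1}" for t
    using dist_le_path_length[of 0 t g] that len g0 by auto
  then have img: "path_image g \<subseteq> {s}"
    by (auto simp: path_image_def)
  have "set es = obstacle_endpoints Ob \<inter> path_image g - {pathstart g, pathfinish g}"
    using g(2) by (simp only: passes_through_def)
  also have "pathstart g = s"
    using g0 by (simp only: pathstart_def)
  also have "obstacle_endpoints Ob \<inter> path_image g - {s, pathfinish g} = {}"
    using img by blast
  finally have "set es = {}" .
  then show "es = []"
    by simp
qed

lemma kernel_sequence_eq:
  assumes "s \<in> free_space Ob"
  shows "kernel_sequence Ob s = []"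
  using start_in_spm_region_iff[OF assms] by (auto simp: kernel_sequence_def)

end

theory Submission
  imports Defs
begin

text \<open>
  Call two points visible if the segment between them meets no obstacle except by running along it,
  and call a polygonal line with visible edges bending only at obstacle endpoints a route. If \<open>v\<close>
  sees \<open>x\<close> and \<open>x\<close> sees \<open>y\<close>, then sweeping a ray from \<open>v\<close> across the triangle \<open>v x y\<close> until it hits
  the first obstacle endpoint, and recursing on the remaining triangle, gives a route from \<open>v\<close> to
  \<open>y\<close> that is no longer than the detour over \<open>x\<close>. Consecutive points of a fine partition of an
  avoiding path see each other, so every avoiding path dominates a route. Only finitely many routes
  matter, hence shortest paths exist. The same sweep shows that the piece of a shortest path after
  the control point is straight: a shortcut around the first endpoint would be strictly shorter,
  unless that endpoint lies on the path itself. Therefore \<open>\<pi>(s, p) = \<pi>(s, e) + |e p|\<close> on the region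
  with control point \<open>e\<close>, and \<open>\<pi>(s, p) = |s p|\<close> on the kernel region.
\<close>

section \<open>Visibility\<close>

text \<open>Twice the signed area of the triangle \<open>a b q\<close>; for
  \<open>a \<noteq> b\<close> it vanishes exactly on the line through \<open>a\<close> and
  \<open>b\<close>.\<close>

definition orient :: "point \<Rightarrow> point \<Rightarrow> point \<Rightarrow> real" where
  "orient a b q = (b$1 - a$1) * (q$2 - a$2) - (b$2 - a$2) * (q$1 - a$1)"

lemma orient_affine:
  "orient a b ((1 - t) *\<^sub>R p + t *\<^sub>R q) = (1 - t) * orient a b p + t * orient a b q"
  by (simp add: orient_def algebra_simps)

lemma orient_zero_on_segment:
  assumes "orient a b p = 0" "orient a b q = 0" "w \<in> closed_segment p q"
  shows "orient a b w = 0"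
  using assms by (auto simp: in_segment orient_affine)

lemma orient_zero_line:
  assumes "a \<noteq> b" "orient a b q = 0"
  obtains k where "q = a + k *\<^sub>R (b - a)"
proof (cases "b$1 = a$1")
  case True
  with assms(1) have ne: "b$2 \<noteq> a$2"
    by (auto simp: vec_eq_iff forall_2)
  then have "q = a + ((q$2 - a$2) / (b$2 - a$2)) *\<^sub>R (b - a)"
    using assms(2) True by (auto simp: vec_eq_iff forall_2 orient_def)
  then show ?thesis by (rule that)
next
  case False
  then have "q$2 - a$2 = (q$1 - a$1) / (b$1 - a$1) * (b$2 - a$2)"
    using assms(2) by (simp add: orient_def nonzero_eq_divide_eq mult.commute)
  with False have "q = a + ((q$1 - a$1) / (b$1 - a$1)) *\<^sub>R (b - a)"
    by (simp add: vec_eq_iff forall_2)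
  then show ?thesis by (rule that)
qed

lemma orient_zero_trans:
  assumes "a \<noteq> b" "orient a b p = 0" "orient a b q = 0" "orient a b r = 0"
  shows "orient p q r = 0"
proof -
  obtain i j k where eqs: "p = a + i *\<^sub>R (b - a)" "q = a + j *\<^sub>R (b - a)" "r = a + k *\<^sub>R (b - a)"
    using assms orient_zero_line by metis
  show ?thesis
    unfolding eqs by (simp add: orient_def algebra_simps)
qed

lemma orient_zero_extend:
  assumes "p \<noteq> q" "orient a b p = 0" "orient a b q = 0" "orient p q r = 0"
  shows "orient a b r = 0"
proof -
  obtain k where "r = p + k *\<^sub>R (q - p)"
    using assms orient_zero_line by metis
  then have "r = (1 - k) *\<^sub>R p + k *\<^sub>R q"
    by (simp add: algebra_simps)
  then show ?thesis
    using assms by (simp add: orient_affine)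
qed

lemma orient_swap: "orient b a q = - orient a b q"
  by (simp add: orient_def algebra_simps)

lemma orient_self [simp]: "orient a b a = 0" "orient a b b = 0" "orient a a b = 0"
  by (simp_all add: orient_def)

lemma collinear_if_orient_zero:
  assumes "orient v x y = 0"
  shows "collinear {v, x, y}"
proof (cases "v = x")
  case False
  then obtain k where "y = v + k *\<^sub>R (x - v)"
    using assms orient_zero_line by metis
  then show ?thesis
    unfolding collinear_def
    by (intro exI[of _ "x - v"])
      (auto intro: exI[of _ 0] exI[of _ 1] exI[of _ "-1"] exI[of _ k] exI[of _ "-k"]
        exI[of _ "1 - k"] exI[of _ "k - 1"] simp: algebra_simps)
qed simp

text \<open>Contact with an obstacle is tolerated only when both ends lie on its line, so a sight
  line may run along an obstacle and past its ends, but neither cross it nor leave its interior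
  sideways.\<close>

definition visible :: "(point \<times> point) set \<Rightarrow> point \<Rightarrow> point \<Rightarrow> bool" where
  "visible Ob x y \<longleftrightarrow>
     (\<forall>(a, b) \<in> Ob. closed_segment x y \<inter> open_segment a b \<noteq> {} \<longrightarrow>
        orient a b x = 0 \<and> orient a b y = 0)"

lemma visibleD:
  assumes "visible Ob x y" "(a, b) \<in> Ob" "w \<in> closed_segment x y" "w \<in> open_segment a b"
  shows "orient a b x = 0" "orient a b y = 0"
  using assms unfolding visible_def by blast+

lemma visible_sym: "visible Ob x y \<longleftrightarrow> visible Ob y x"
  unfolding visible_def by (auto simp: closed_segment_commute)

lemma visible_subsegment:
  assumes "visible Ob x y" "p \<in> closed_segment x y" "q \<in> closed_segment x y"
  shows "visible Ob p q"
  unfolding visible_def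
proof (clarify)
  fix a b
  assume ab: "(a, b) \<in> Ob" and ne: "closed_segment p q \<inter> open_segment a b \<noteq> {}"
  have "closed_segment p q \<subseteq> closed_segment x y"
    using assms by (simp add: subset_closed_segment)
  with ne obtain w where "w \<in> closed_segment x y" "w \<in> open_segment a b"
    by blast
  from visibleD[OF assms(1) ab this] assms(2,3)
  show "orient a b p = 0 \<and> orient a b q = 0"
    using orient_zero_on_segment by blast
qed

text \<open>If \<open>x\<close> lies between, an obstacle met by \<open>v y\<close> meets one half;
  that half lies on its line, and collinearity carries the third point along. In other orders
  \<open>v y\<close> is one of the given segments or part of one.\<close>

lemma visible_collinear:
  assumes "orient v x y = 0" "visible Ob v x" "visible Ob x y"
  shows "visible Ob v y"
proof -
  consider "v = x \<or> x = y" | "v \<in> closed_segment x y" | "y \<in> closed_segment v x"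
    | "v \<noteq> x" "x \<noteq> y" "x \<in> closed_segment v y"
    using collinear_if_orient_zero[OF assms(1)]
    unfolding collinear_between_cases between_mem_segment
    by (auto simp: closed_segment_commute)
  then show ?thesis
  proof cases
    case 1
    then show ?thesis using assms by auto
  next
    case 2
    then show ?thesis using visible_subsegment[OF assms(3)] by simp
  next
    case 3
    then show ?thesis using visible_subsegment[OF assms(2)] by simp
  next
    case 4
    show ?thesis
      unfolding visible_def
    proof (clarify)
      fix a b
      assume ab: "(a, b) \<in> Ob" and ne: "closed_segment v y \<inter> open_segment a b \<noteq> {}"
      then obtain w where w: "w \<in> open_segment a b"
        and "w \<in> closed_segment v x \<or> w \<in> closed_segment x y"
        using Un_closed_segment[OF 4(3)] by blast
      moreover have "a \<noteq> b"
        using w by auto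
      ultimately have "orient a b x = 0" "orient a b v = 0 \<or> orient a b y = 0"
        using visibleD[OF assms(2) ab] visibleD[OF assms(3) ab] by blast+
      moreover have "orient x y v = 0" "orient v x y = 0"
        using assms(1) by (auto simp: orient_def algebra_simps)
      ultimately show "orient a b v = 0 \<and> orient a b y = 0"
        using 4 orient_zero_extend[of x y a b v] orient_zero_extend[of v x a b y] by blast
    qed
  qed
qed

section \<open>Barycentric coordinates and the sweep across a triangle\<close>

text \<open>Cramer's rule for \<open>q - v\<close> in the basis \<open>x - v\<close>,
  \<open>y - v\<close>.\<close>

lemma barycentric_repr:
  assumes "orient v x y \<noteq> 0"
  shows "q = v + (orient v q y / orient v x y) *\<^sub>R (x - v)
    + (orient v x q / orient v x y) *\<^sub>R (y - v)" (is "_ = ?r")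
proof -
  have "orient v x y *\<^sub>R q
      = orient v x y *\<^sub>R v + orient v q y *\<^sub>R (x - v) + orient v x q *\<^sub>R (y - v)"
    by (simp add: vec_eq_iff forall_2 orient_def algebra_simps)
  also have "\<dots> = orient v x y *\<^sub>R ?r"
    using assms by (simp add: scaleR_add_right)
  finally show ?thesis
    using assms by simp
qed

text \<open>\<open>A\<close> and \<open>B\<close> are the barycentric coordinates with respect to \<open>x\<close> and \<open>y\<close>. An obstacle crossing
  the segment from \<open>v\<close> to \<open>z\<close> would have to end inside the triangle \<open>v x z\<close> or leave it through one
  of the unobstructed sides \<open>v x\<close> and \<open>x z\<close>.\<close>

lemma visible_from_apex:
  fixes \<tau> :: real
  assumes nc: "orient v x y \<noteq> 0" and v: "v \<in> free_space Ob"
    and vx: "visible Ob v x" and xy: "visible Ob x y"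
    and \<tau>: "0 \<le> \<tau>" "\<tau> \<le> 1" and z: "z = (1 - \<tau>) *\<^sub>R x + \<tau> *\<^sub>R y"
    and A_def: "\<And>q. A q = orient v q y / orient v x y"
    and B_def: "\<And>q. B q = orient v x q / orient v x y"
    and no: "\<And>e. e \<in> obstacle_endpoints Ob \<Longrightarrow> A e \<ge> 0 \<Longrightarrow> B e \<ge> 0 \<Longrightarrow> A e + B e \<le> 1 \<Longrightarrow>
        (1 - \<tau>) * B e \<ge> \<tau> * A e"
  shows "visible Ob v z"
proof (cases "\<tau> = 0")
  case True
  then show ?thesis using vx z by simp
next
  case False
  then have \<tau>0: "\<tau> > 0" using \<tau> by simp
  \<comment> \<open>\<open>f\<close> vanishes exactly on the line \<open>v z\<close> and is negative
    on the side of \<open>x\<close>; \<open>C\<close> is the third barycentric coordinate, the one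
    belonging to \<open>v\<close>.\<close>
  define f where "f q = (1 - \<tau>) * B q - \<tau> * A q" for q
  define C where "C q = 1 - A q - B q" for q
  have B_aff: "B ((1 - t) *\<^sub>R p + t *\<^sub>R q) = (1 - t) * B p + t * B q" for t p q
    unfolding B_def orient_affine by (simp add: add_divide_distrib)
  have A_alt: "A q = - orient v y q / orient v x y" for q
    by (simp add: A_def orient_def algebra_simps)
  have A_aff: "A ((1 - t) *\<^sub>R p + t *\<^sub>R q) = (1 - t) * A p + t * A q" for t p q
    unfolding A_alt orient_affine by (simp add: add_divide_distrib diff_divide_distrib algebra_simps)
  have C_aff: "C ((1 - t) *\<^sub>R p + t *\<^sub>R q) = (1 - t) * C p + t * C q" for t p q
    unfolding C_def A_aff B_aff by (simp add: algebra_simps)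
  have f_aff: "f ((1 - t) *\<^sub>R p + t *\<^sub>R q) = (1 - t) * f p + t * f q" for t p q
    unfolding f_def A_aff B_aff by (simp add: algebra_simps)
  have vals: "A v = 0" "B v = 0" "A x = 1" "B x = 0" "A y = 0" "B y = 1"
    using nc by (auto simp: A_def B_def orient_def)
  have repr: "q = v + A q *\<^sub>R (x - v) + B q *\<^sub>R (y - v)" for q
    unfolding A_def B_def by (rule barycentric_repr[OF nc])
  have zval: "A z = 1 - \<tau>" "B z = \<tau>"
    unfolding z A_aff B_aff vals by simp_all
  have main: False
    if ab: "(a, b) \<in> Ob \<or> (b, a) \<in> Ob" and w: "w \<in> closed_segment v z" "w \<in> open_segment a b"
      and fa: "f a < 0" for a b w
  proof -
    obtain \<sigma> where \<sigma>: "0 \<le> \<sigma>" "\<sigma> \<le> 1" "w = (1 - \<sigma>) *\<^sub>R v + \<sigma> *\<^sub>R z"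
      using w(1) by (auto simp: in_segment)
    have wv: "w \<noteq> v"
      using v w(2) ab by (auto simp: free_space_def open_segment_commute)
    then have \<sigma>0: "\<sigma> > 0"
      using \<sigma> by (cases "\<sigma> = 0") auto
    have wval: "A w = \<sigma> * (1 - \<tau>)" "B w = \<sigma> * \<tau>" "C w = 1 - \<sigma>"
      unfolding C_def \<sigma>(3) A_aff B_aff vals zval by (simp_all add: algebra_simps)
    then have fw: "f w = 0"
      by (simp add: f_def)
    have Bw: "B w > 0" and Cw: "C w \<ge> 0"
      using \<sigma>0 \<tau>0 \<sigma>(2) by (simp_all add: wval)
    have Apos: "A q \<ge> 0" if "B q \<ge> 0" "f q \<le> 0" for q
    proof -
      have "\<tau> * A q \<ge> 0"
        using that mult_nonneg_nonneg[of "1 - \<tau>" "B q"] \<tau> unfolding f_def by linarith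
      then show ?thesis
        using \<tau>0 by (simp add: zero_le_mult_iff)
    qed
    have "a \<in> obstacle_endpoints Ob"
      using ab by (force simp: obstacle_endpoints_def)
    \<comment> \<open>By \<open>no\<close> the end \<open>a\<close> lies outside the triangle; being
      on the side of \<open>x\<close>, it is beyond \<open>v x\<close> or beyond
      \<open>x y\<close>.\<close>
    then have out: "B a < 0 \<or> C a < 0"
      using no[of a] Apos[of a] fa unfolding f_def C_def by linarith
    \<comment> \<open>A walk from the contact point \<open>w\<close> to the end \<open>a\<close>,
      inside the obstacle until it arrives.\<close>
    define u where "u r = (1 - r) *\<^sub>R w + r *\<^sub>R a" for r
    have u_open: "u r \<in> open_segment a b" if "0 \<le> r" "r < 1" for r
    proof -
      obtain t where t: "0 < t" "t < 1" "w = (1 - t) *\<^sub>R a + t *\<^sub>R b" and "a \<noteq> b"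
        using w(2) by (auto simp: in_segment)
      moreover have "u r = (1 - (1 - r) * t) *\<^sub>R a + ((1 - r) * t) *\<^sub>R b"
        by (simp add: u_def t(3) algebra_simps)
      moreover have "0 < (1 - r) * t" "(1 - r) * t < 1"
        using that t mult_le_less_imp_less[of "1 - r" 1 t 1] by auto
      ultimately show ?thesis
        unfolding in_segment by blast
    qed
    have fu: "f (u r) = r * f a" for r
      by (simp add: u_def f_aff fw)
    have ab_ne: "a \<noteq> b"
      using w(2) by auto
    have crossB: False if r: "0 < r" "r < 1" "B (u r) = 0" "C (u r) \<ge> 0" "B a < 0" for r
    proof -
      have fu0: "f (u r) < 0"
        using r fa by (simp add: fu mult_pos_neg)
      have A0: "A (u r) \<ge> 0" "A (u r) \<le> 1"
        using Apos[of "u r"] r fu0 by (auto simp: C_def)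
      have "u r = (1 - A (u r)) *\<^sub>R v + A (u r) *\<^sub>R x"
        using repr[of "u r"] r(3) by (simp add: algebra_simps)
      then have mem: "u r \<in> closed_segment v x"
        using A0 unfolding in_segment by blast
      have uo: "u r \<in> open_segment a b" "u r \<in> open_segment b a"
        using u_open[of r] r(1,2) open_segment_commute by auto
      have "orient a b v = 0" "orient a b x = 0"
        using ab visibleD[OF vx _ mem uo(1)] visibleD[OF vx _ mem uo(2)]
          orient_swap[of b a v] orient_swap[of b a x] by auto
      then have "orient v x a = 0"
        using ab_ne by (simp add: orient_zero_trans[of a b])
      then show False
        using r by (simp add: B_def)
    qed
    have crossC: False if r: "0 \<le> r" "r < 1" "C (u r) = 0" "B (u r) \<ge> 0" "C a < 0" for r
    proof -
      have fu0: "f (u r) \<le> 0"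
        using r fa by (simp add: fu mult_nonneg_nonpos)
      have A0: "A (u r) \<ge> 0" "B (u r) \<le> 1" "A (u r) = 1 - B (u r)"
        using Apos[of "u r"] r fu0 by (auto simp: C_def)
      have "u r = (1 - B (u r)) *\<^sub>R x + B (u r) *\<^sub>R y"
        using repr[of "u r"] A0(3) by (simp add: algebra_simps)
      then have mem: "u r \<in> closed_segment x y"
        using A0 r unfolding in_segment by blast
      have uo: "u r \<in> open_segment a b" "u r \<in> open_segment b a"
        using u_open[of r] r(1,2) open_segment_commute by auto
      have "orient a b x = 0" "orient a b y = 0"
        using ab visibleD[OF xy _ mem uo(1)] visibleD[OF xy _ mem uo(2)]
          orient_swap[of b a x] orient_swap[of b a y] by auto
      then have "orient x y a = 0"
        using ab_ne by (simp add: orient_zero_trans[of a b])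
      moreover have "orient x y a = orient v x y - orient v a y - orient v x a"
        by (simp add: orient_def algebra_simps)
      ultimately have "C a = 0"
        using nc by (simp add: C_def A_def B_def field_simps)
      then show False
        using r by simp
    qed
    have Bu: "B (u r) = (1 - r) * B w + r * B a" and Cu: "C (u r) = (1 - r) * C w + r * C a" for r
      by (simp_all add: u_def B_aff C_aff)
    \<comment> \<open>The parameters at which the walk meets the lines \<open>v x\<close> and
      \<open>x y\<close> when \<open>a\<close> lies beyond them. The earlier one is the exit from
      the triangle, where visibility of that side forces the whole obstacle onto its line, contrary
      to the position of \<open>a\<close>.\<close>
    define rB where "rB = B w / (B w - B a)"
    define rC where "rC = C w / (C w - C a)"
    have rB: "0 < rB" "rB < 1" "B (u rB) = 0" "\<And>r. r \<le> rB \<Longrightarrow> B (u r) \<ge> 0" if "B a < 0"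
    proof -
      have D: "B w - B a > 0"
        using that Bw by linarith
      then show "0 < rB" "rB < 1"
        using that Bw by (simp_all add: rB_def)
      have mult: "rB * (B w - B a) = B w"
        using D by (simp add: rB_def)
      then show "B (u rB) = 0"
        by (simp add: Bu algebra_simps)
      show "B (u r) \<ge> 0" if "r \<le> rB" for r
        using mult_right_mono[OF that, of "B w - B a"] D mult by (simp add: Bu algebra_simps)
    qed
    have rC: "0 \<le> rC" "rC < 1" "C (u rC) = 0" "\<And>r. r \<le> rC \<Longrightarrow> C (u r) \<ge> 0" if "C a < 0"
    proof -
      have D: "C w - C a > 0"
        using that Cw by linarith
      then show "0 \<le> rC" "rC < 1"
        using that Cw by (simp_all add: rC_def)
      have mult: "rC * (C w - C a) = C w"
        using D by (simp add: rC_def)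
      then show "C (u rC) = 0"
        by (simp add: Cu algebra_simps)
      show "C (u r) \<ge> 0" if "r \<le> rC" for r
        using mult_right_mono[OF that, of "C w - C a"] D mult by (simp add: Cu algebra_simps)
    qed
    have rBn: "B (u r) \<ge> 0" if "B a \<ge> 0" "0 \<le> r" "r < 1" for r
      using that Bw by (simp add: Bu)
    have rCn: "C (u r) \<ge> 0" if "C a \<ge> 0" "0 \<le> r" "r < 1" for r
      using that Cw by (simp add: Cu)
    show False
      using out crossB[of rB] crossC[of rC] rB rC rBn[of rC] rCn[of rB]
      by (smt (verit))
  qed
  show ?thesis
    unfolding visible_def
  proof (clarify)
    fix a b
    assume ab: "(a, b) \<in> Ob" and "closed_segment v z \<inter> open_segment a b \<noteq> {}"
    then obtain w where w: "w \<in> closed_segment v z" "w \<in> open_segment a b"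
      by blast
    have fw: "f w = 0"
      using w(1) by (auto simp: in_segment f_aff) (auto simp: f_def vals zval)
    \<comment> \<open>Both ends lie on the closed side of \<open>y\<close>, while an interior point
      lies on the line \<open>v z\<close>; so the whole obstacle does.\<close>
    have nn: "f a \<ge> 0" "f b \<ge> 0"
      using main[of a b w] main[of b a w] ab w by (auto simp: open_segment_commute not_less[symmetric])
    obtain t where t: "0 < t" "t < 1" "w = (1 - t) *\<^sub>R a + t *\<^sub>R b" and ne: "a \<noteq> b"
      using w(2) by (auto simp: in_segment)
    have "(1 - t) * f a + t * f b = 0"
      using fw unfolding t(3) f_aff .
    then have "(1 - t) * f a = 0" "t * f b = 0"
      using nn t mult_nonneg_nonneg[of "1 - t" "f a"] mult_nonneg_nonneg[of t "f b"] by linarith+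
    then have "f a = 0" "f b = 0"
      using t by auto
    moreover have forient: "orient v z q = orient v x y * f q" for q
    proof -
      have "orient v z q = (1 - \<tau>) * orient v x q - \<tau> * orient v q y"
        unfolding z by (simp add: orient_def algebra_simps)
      then show ?thesis
        using nc by (simp add: f_def A_def B_def right_diff_distrib)
    qed
    ultimately have "orient v z a = 0" "orient v z b = 0"
      by simp_all
    moreover have "v \<noteq> z"
      using vals zval \<tau>0 by auto
    ultimately show "orient a b v = 0 \<and> orient a b z = 0"
      using orient_zero_trans[of v z a b v] orient_zero_trans[of v z a b z] by simp
  qed
qed

text \<open>\<open>\<tau> e\<close> is the position on \<open>x y\<close> hit by the ray from
  \<open>v\<close> through \<open>e\<close>. The endpoint with the smallest value is the first one
  met by the sweep starting at \<open>x\<close>, so \<open>v\<close> still sees the corresponding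
  \<open>z\<close>. Without any endpoint besides \<open>v\<close> in the triangle the sweep would
  reach \<open>y\<close>.\<close>

lemma triangle_blocking_endpoint:
  assumes fin: "finite Ob" and nc: "orient v x y \<noteq> 0" and v: "v \<in> free_space Ob"
    and vx: "visible Ob v x" and xy: "visible Ob x y" and nvy: "\<not> visible Ob v y"
  obtains e z where "e \<in> obstacle_endpoints Ob" "e \<noteq> v" "z \<in> closed_segment x y"
    "e \<in> closed_segment v z" "visible Ob v z"
proof -
  define A where "A q = orient v q y / orient v x y" for q
  define B where "B q = orient v x q / orient v x y" for q
  define S where "S = {e \<in> obstacle_endpoints Ob. e \<noteq> v \<and> A e \<ge> 0 \<and> B e \<ge> 0 \<and> A e + B e \<le> 1}"
  define \<tau> where "\<tau> e = B e / (A e + B e)" for e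
  have repr: "q = v + A q *\<^sub>R (x - v) + B q *\<^sub>R (y - v)" for q
    unfolding A_def B_def by (rule barycentric_repr[OF nc])
  have pos: "A e + B e > 0" if "e \<in> S" for e
  proof (rule ccontr)
    assume "\<not> A e + B e > 0"
    then have "A e = 0" "B e = 0"
      using that by (auto simp: S_def)
    then have "e = v"
      using repr[of e] by simp
    then show False
      using that by (simp add: S_def)
  qed
  have AB_v: "A v = 0" "B v = 0"
    by (auto simp: A_def B_def orient_def)
  have finS: "finite S"
    using fin by (auto simp: S_def obstacle_endpoints_def)
  have "S \<noteq> {}"
  proof
    assume "S = {}"
    then have "visible Ob v y"
      by (intro visible_from_apex[OF nc v vx xy, of 1 y A B])
        (use AB_v in \<open>auto simp: S_def A_def B_def\<close>)
    then show False
      using nvy by simp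
  qed
  then obtain e where e: "e \<in> S" and min: "\<And>e'. e' \<in> S \<Longrightarrow> \<tau> e \<le> \<tau> e'"
    using arg_min_if_finite(1)[OF finS, of \<tau>] arg_min_least[OF finS, of _ \<tau>] by blast
  define z where "z = (1 - \<tau> e) *\<^sub>R x + \<tau> e *\<^sub>R y"
  have \<tau>: "0 \<le> \<tau> e" "\<tau> e \<le> 1"
    using e pos[OF e] by (auto simp: \<tau>_def S_def)
  have "visible Ob v z"
  proof (rule visible_from_apex[OF nc v vx xy \<tau> z_def A_def B_def])
    fix e'
    assume e': "e' \<in> obstacle_endpoints Ob" "A e' \<ge> 0" "B e' \<ge> 0" "A e' + B e' \<le> 1"
    show "(1 - \<tau> e) * B e' \<ge> \<tau> e * A e'"
    proof (cases "e' = v")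
      case True
      then show ?thesis by (simp add: AB_v)
    next
      case False
      with e' have "e' \<in> S" by (simp add: S_def)
      then have "\<tau> e * (A e' + B e') \<le> B e'"
        using min[of e'] pos[of e'] unfolding \<tau>_def[of e'] by (simp add: pos_le_divide_eq)
      then show ?thesis by (simp add: algebra_simps)
    qed
  qed
  moreover have "z \<in> closed_segment x y"
    using \<tau> unfolding z_def in_segment by blast
  moreover have "e \<in> closed_segment v z"
  proof -
    define k where "k = A e + B e"
    have k: "k \<noteq> 0" "0 \<le> k" "k \<le> 1"
      using pos[OF e] e by (auto simp: S_def k_def)
    have B: "B e = k * \<tau> e"
      using k by (simp add: \<tau>_def k_def)
    then have A: "A e = k - k * \<tau> e"
      by (simp add: k_def)
    have "e = v + (k - k * \<tau> e) *\<^sub>R (x - v) + (k * \<tau> e) *\<^sub>R (y - v)"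
      using repr[of e] unfolding A B .
    also have "\<dots> = (1 - k) *\<^sub>R v + k *\<^sub>R z"
      by (simp add: z_def algebra_simps)
    finally have "e = (1 - k) *\<^sub>R v + k *\<^sub>R z" .
    then show ?thesis
      using k unfolding in_segment by blast
  qed
  ultimately show ?thesis
    using that e by (auto simp: S_def)
qed

section \<open>Routes through obstacle endpoints\<close>

text \<open>The list holds only the bends, so \<open>[]\<close> is the single edge from
  \<open>p\<close> to \<open>q\<close>; the two ends may be arbitrary points.\<close>

fun route :: "(point \<times> point) set \<Rightarrow> point \<Rightarrow> point list \<Rightarrow> point \<Rightarrow> bool" where
  "route Ob p [] q \<longleftrightarrow> visible Ob p q"
| "route Ob p (e # es) q \<longleftrightarrow> e \<in> obstacle_endpoints Ob \<and> visible Ob p e \<and> route Ob e es q"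

fun route_length :: "point \<Rightarrow> point list \<Rightarrow> point \<Rightarrow> real" where
  "route_length p [] q = dist p q"
| "route_length p (e # es) q = dist p e + route_length e es q"

lemma route_append:
  "route Ob p (es @ e # fs) q \<longleftrightarrow>
     e \<in> obstacle_endpoints Ob \<and> route Ob p es e \<and> route Ob e fs q"
  by (induction es arbitrary: p) auto

lemma route_length_append:
  "route_length p (es @ e # fs) q = route_length p es e + route_length e fs q"
  by (induction es arbitrary: p) auto

lemma route_length_nonneg: "0 \<le> route_length p es q"
  by (induction es arbitrary: p) auto

lemma route_endpoints: "route Ob p es q \<Longrightarrow> set es \<subseteq> obstacle_endpoints Ob"
  by (induction es arbitrary: p) auto

lemma endpoint_free:
  assumes "segment_obstacles Ob" "e \<in> obstacle_endpoints Ob"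
  shows "e \<in> free_space Ob"
proof -
  obtain a b where ab: "(a, b) \<in> Ob" "e = a \<or> e = b"
    using assms(2) by (auto simp: obstacle_endpoints_def)
  have "e \<notin> open_segment c d" if cd: "(c, d) \<in> Ob" for c d
  proof (cases "(c, d) = (a, b)")
    case True
    then show ?thesis using ab by (auto simp: open_segment_def)
  next
    case False
    then have "closed_segment a b \<inter> closed_segment c d = {}"
      using assms(1) ab cd unfolding segment_obstacles_def disjoint_family_on_def by fastforce
    then show ?thesis
      using ab by (auto simp: open_segment_def)
  qed
  then show ?thesis
    by (auto simp: free_space_def)
qed

section \<open>Shortening a detour across a triangle\<close>

text \<open>Induction on the number of obstacle endpoints in the triangle other than the apex. The
  first endpoint \<open>e\<close> of the sweep becomes a bend and the apex of the smaller triangle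
  \<open>e z y\<close>; the triangle inequality at \<open>x\<close> pays for the shortcut
  \<open>v z\<close>.\<close>

lemma route_around_triangle:
  assumes Ob: "segment_obstacles Ob"
    and v: "v \<in> free_space Ob" "visible Ob v x" "visible Ob x y"
  shows "\<exists>es. route Ob v es y \<and> route_length v es y \<le> dist v x + dist x y"
  using v
proof (induction "card (obstacle_endpoints Ob \<inter> convex hull {v, x, y} - {v})"
    arbitrary: v x rule: less_induct)
  case less
  have fin: "finite Ob"
    using Ob by (simp add: segment_obstacles_def)
  show ?case
  proof (cases "visible Ob v y")
    case True
    then show ?thesis
      by (intro exI[of _ "[]"]) (simp add: dist_triangle)
  next
    case False
    then have nc: "orient v x y \<noteq> 0"
      using visible_collinear less.prems by blast
    from triangle_blocking_endpoint[OF fin nc less.prems False]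
    obtain e z where e: "e \<in> obstacle_endpoints Ob" "e \<noteq> v" "z \<in> closed_segment x y"
      "e \<in> closed_segment v z" "visible Ob v z" .
    have vis: "visible Ob v e" "visible Ob e z" "visible Ob z y"
      using visible_subsegment[OF e(5)] visible_subsegment[OF less.prems(3)] e by auto
    let ?H = "convex hull {v, x, y}"
    have H: "v \<in> ?H" "x \<in> ?H" "y \<in> ?H"
      by (auto intro: hull_inc)
    have zH: "z \<in> ?H"
      using e(3) H closed_segment_subset[of x ?H y] by auto
    have eH: "e \<in> ?H"
      using e(4) H(1) zH closed_segment_subset[of v ?H z] by auto
    have sub: "convex hull {e, z, y} \<subseteq> ?H"
      using eH zH H by (intro hull_minimal) auto
    \<comment> \<open>The smaller count excludes \<open>e\<close> instead of \<open>v\<close>, so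
      \<open>v\<close>, if it is an endpoint, must not reappear. The normalised height above
      \<open>x y\<close> is 1 at \<open>v\<close> and below 1 at \<open>e\<close>, \<open>z\<close>
      and \<open>y\<close>.\<close>
    have vnot: "v \<notin> convex hull {e, z, y}"
    proof -
      let ?S = "{q. orient x y q / orient v x y < 1}"
      obtain k where k: "0 \<le> k" "e = (1 - k) *\<^sub>R v + k *\<^sub>R z"
        using e(4) by (auto simp: in_segment)
      with e(2) have "k > 0"
        by (cases "k = 0") auto
      have xyv: "orient x y v = orient v x y"
        by (simp add: orient_def algebra_simps)
      have z0: "orient x y z = 0"
        using orient_zero_on_segment[of x y x y z] e(3) by simp
      have "e \<in> ?S"
        using nc \<open>k > 0\<close> unfolding k(2) by (simp add: orient_affine z0 xyv)
      moreover have "convex ?S"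
        unfolding convex_alt
      proof (clarify)
        fix p q and t :: real
        assume pq: "orient x y p / orient v x y < 1" "orient x y q / orient v x y < 1"
          and t: "0 \<le> t" "t \<le> 1"
        have "(1 - t) * (orient x y p / orient v x y) + t * (orient x y q / orient v x y) < 1"
          by (rule convex_bound_lt[OF pq]) (use t in auto)
        then show "orient x y ((1 - t) *\<^sub>R p + t *\<^sub>R q) / orient v x y < 1"
          by (simp add: orient_affine add_divide_distrib)
      qed
      ultimately have "convex hull {e, z, y} \<subseteq> ?S"
        by (intro hull_minimal) (simp_all add: z0)
      then show ?thesis
        using xyv nc by auto
    qed
    have "obstacle_endpoints Ob \<inter> convex hull {e, z, y} - {e}
        \<subset> obstacle_endpoints Ob \<inter> ?H - {v}"
      using sub vnot e(1,2) eH by blast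
    then have "card (obstacle_endpoints Ob \<inter> convex hull {e, z, y} - {e})
        < card (obstacle_endpoints Ob \<inter> ?H - {v})"
      using fin by (intro psubset_card_mono) (auto simp: obstacle_endpoints_def)
    from less.hyps[OF this endpoint_free[OF Ob e(1)] vis(2,3)]
    obtain es where es: "route Ob e es y" "route_length e es y \<le> dist e z + dist z y"
      by blast
    have "dist v e + dist e z = dist v z" "dist x z + dist z y = dist x y"
      using e(3,4) by (simp_all add: between_mem_segment[symmetric] between)
    then have "route_length v (e # es) y \<le> dist v x + dist x y"
      using es(2) dist_triangle[of v z x] by simp
    then show ?thesis
      using es vis e by (intro exI[of _ "e # es"]) auto
  qed
qed

text \<open>If the sweep stops at once, at \<open>z = x\<close>, the blocking endpoint lies on
  \<open>v x\<close>. Otherwise going over \<open>z\<close> saves length by the strict triangle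
  inequality, as \<open>x\<close> is off the line \<open>v z\<close>.\<close>

lemma blocked_triangle_cases:
  assumes Ob: "segment_obstacles Ob"
    and v: "v \<in> free_space Ob" "visible Ob v x" "visible Ob x y" and "\<not> visible Ob v y"
  shows "(\<exists>e \<in> obstacle_endpoints Ob. e \<noteq> v \<and> e \<in> closed_segment v x) \<or>
    (\<exists>es. route Ob v es y \<and> route_length v es y < dist v x + dist x y)"
proof -
  have fin: "finite Ob"
    using Ob by (simp add: segment_obstacles_def)
  have nc: "orient v x y \<noteq> 0"
    using visible_collinear assms by blast
  from triangle_blocking_endpoint[OF fin nc assms(2-5)]
  obtain e z where e: "e \<in> obstacle_endpoints Ob" "e \<noteq> v" "z \<in> closed_segment x y"
    "e \<in> closed_segment v z" "visible Ob v z" .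
  show ?thesis
  proof (cases "z = x")
    case True
    then show ?thesis using e by blast
  next
    case False
    have "visible Ob z y"
      using visible_subsegment[OF v(3)] e(3) by auto
    from route_around_triangle[OF Ob v(1) e(5) this]
    obtain es where es: "route Ob v es y" "route_length v es y \<le> dist v z + dist z y"
      by blast
    have "dist v z < dist v x + dist x z"
    proof (rule ccontr)
      assume "\<not> ?thesis"
      then have x: "x \<in> closed_segment v z"
        using dist_triangle[of v z x] by (simp add: between_mem_segment[symmetric] between)
      have "orient v z x = 0" "orient x y z = 0"
        using orient_zero_on_segment[of v z v z x] orient_zero_on_segment[of x y x y z] x e(3)
        by simp_all
      then have "orient x z v = 0" "orient x z y = 0"
        by (simp_all add: orient_def algebra_simps)
      then show False
        using False nc orient_zero_trans[of x z v x y] by auto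
    qed
    moreover have "dist x z + dist z y = dist x y"
      using e(3) by (simp add: between_mem_segment[symmetric] between)
    ultimately show ?thesis
      using es by force
  qed
qed

text \<open>The point \<open>x\<close> need not be an obstacle endpoint and so cannot simply become
  a bend; the last edge into \<open>x\<close> and the edge \<open>x y\<close> are replaced together
  by a route around their triangle.\<close>

lemma route_extend:
  assumes Ob: "segment_obstacles Ob" and s: "s \<in> free_space Ob"
    and es: "route Ob s es x" and xy: "visible Ob x y"
  shows "\<exists>fs. route Ob s fs y \<and> route_length s fs y \<le> route_length s es x + dist x y"
proof (cases es rule: rev_cases)
  case Nil
  then show ?thesis
    using route_around_triangle[OF Ob s _ xy] es by auto
next
  case (snoc es' e)
  then have e: "e \<in> obstacle_endpoints Ob" "route Ob s es' e" "visible Ob e x"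
    using es by (auto simp: route_append)
  from route_around_triangle[OF Ob endpoint_free[OF Ob e(1)] e(3) xy]
  obtain fs where "route Ob e fs y" "route_length e fs y \<le> dist e x + dist x y"
    by blast
  then show ?thesis
    using e snoc
    by (intro exI[of _ "es' @ e # fs"]) (auto simp: route_append route_length_append)
qed

lemma route_concat:
  assumes Ob: "segment_obstacles Ob" and s: "s \<in> free_space Ob"
    and "route Ob s es x" "route Ob x fs y"
  shows "\<exists>hs. route Ob s hs y \<and> route_length s hs y \<le> route_length s es x + route_length x fs y"
  using assms(3,4)
proof (induction fs arbitrary: x es)
  case Nil
  then show ?case
    using route_extend[OF Ob s] by simp
next
  case (Cons f fs)
  then have xf: "visible Ob x f" and fs: "route Ob f fs y"
    by simp_all
  from route_extend[OF Ob s Cons.prems(1) xf] obtain gs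
    where gs: "route Ob s gs f" "route_length s gs f \<le> route_length s es x + dist x f"
    by blast
  from Cons.IH[OF gs(1) fs] obtain hs where
    "route Ob s hs y" "route_length s hs y \<le> route_length s gs f + route_length f fs y"
    by blast
  then show ?case
    using gs(2) by (intro exI[of _ hs]) simp
qed

section \<open>Lengths of paths\<close>

fun polygon_length :: "(real \<Rightarrow> point) \<Rightarrow> real list \<Rightarrow> real" where
  "polygon_length g (t # u # ts) = dist (g t) (g u) + polygon_length g (u # ts)"
| "polygon_length g _ = 0"

lemma polygon_length_eq_sum:
  "polygon_length g ts = (\<Sum>i < length ts - 1. dist (g (ts ! i)) (g (ts ! Suc i)))"
proof (induction g ts rule: polygon_length.induct)
  case (1 g t u ts)
  then show ?case
    by (simp add: lessThan_Suc_eq_insert_0 sum.reindex)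
qed auto

lemma polygon_length_le_path_length:
  assumes "sorted ts" "set ts \<subseteq> {0..1}"
  shows "ereal (polygon_length g ts) \<le> path_length g"
  unfolding path_length_def polygon_length_eq_sum by (rule SUP_upper) (use assms in auto)

text \<open>Only an inequality: the edge bridging the two samples is missing on the left.\<close>

lemma polygon_length_append:
  "polygon_length g ts + polygon_length g us \<le> polygon_length g (ts @ us)"
proof (induction g ts rule: polygon_length.induct)
  case ("2_2" g t)
  then show ?case by (cases us) auto
qed auto

lemma path_length_le_potential:
  fixes \<phi> :: "real \<Rightarrow> real"
  assumes "\<And>t u. 0 \<le> t \<Longrightarrow> t \<le> u \<Longrightarrow> u \<le> 1 \<Longrightarrow> dist (g t) (g u) \<le> \<phi> u - \<phi> t"
  shows "path_length g \<le> ereal (\<phi> 1 - \<phi> 0)"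
  unfolding path_length_def
proof (rule SUP_least)
  fix ts :: "real list"
  assume ts: "ts \<in> {ts. sorted ts \<and> set ts \<subseteq> {0..1}}"
  have mono: "\<phi> t \<le> \<phi> u" if "0 \<le> t" "t \<le> u" "u \<le> 1" for t u
    using assms[OF that] zero_le_dist[of "g t" "g u"] by linarith
  have step: "polygon_length g ts \<le> \<phi> 1 - \<phi> (hd ts)" if "sorted ts" "set ts \<subseteq> {0..1}" "ts \<noteq> []" for ts
    using that
  proof (induction ts rule: induct_list012)
    case (3 t u ts)
    then have "polygon_length g (u # ts) \<le> \<phi> 1 - \<phi> u" "dist (g t) (g u) \<le> \<phi> u - \<phi> t"
      using assms[of t u] by auto
    then show ?case
      by simp
  qed (auto intro: mono)
  have "polygon_length g ts \<le> \<phi> 1 - \<phi> 0"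
  proof (cases "ts = []")
    case False
    then have "hd ts \<in> {0..1}"
      using ts hd_in_set by blast
    then show ?thesis
      using step[of ts] ts False mono[of 0 "hd ts"] by auto
  qed (auto intro: mono)
  then show "ereal (\<Sum>i < length ts - 1. dist (g (ts ! i)) (g (ts ! Suc i))) \<le> ereal (\<phi> 1 - \<phi> 0)"
    by (simp add: polygon_length_eq_sum)
qed

text \<open>Turns the openness demanded by \<open>obstacle_avoiding\<close> into compactness, which
  survives reparametrisation and union when paths are joined.\<close>

lemma openin_iff_compact_complement:
  fixes P :: "real \<Rightarrow> bool"
  shows "openin (top_of_set {0..1}) {t \<in> {0..1}. P t} \<longleftrightarrow> compact {t \<in> {0..1}. \<not> P t}"
proof -
  let ?S = "{t \<in> {0..1}. P t}"
  have "{t \<in> {0..1}. \<not> P t} = {0..1} - ?S"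
    by auto
  moreover have "openin (top_of_set {0..1}) ?S \<longleftrightarrow> closedin (top_of_set {0..1}) ({0..1} - ?S)"
    unfolding openin_closedin_eq topspace_euclidean_subtopology using Collect_subset by blast
  moreover have "closedin (top_of_set {0..1}) ({0..1} - ?S) \<longleftrightarrow> compact ({0..1} - ?S)"
    using closedin_compact_eq[OF compact_Icc] by blast
  ultimately show ?thesis
    by (simp only:)
qed

section \<open>Obstacle-avoiding paths that realise routes\<close>

lemma avoiding_linepath:
  assumes vis: "visible Ob p q" and free: "p \<in> free_space Ob" "q \<in> free_space Ob"
  shows "linepath p q \<in> avoiding_paths Ob p q"
proof -
  have "openin (top_of_set {0..1}) {t \<in> {0..1}. linepath p q t \<in> open_segment a b}"
    if ab: "(a, b) \<in> Ob" for a b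
  proof (cases "closed_segment p q \<inter> open_segment a b = {}")
    case True
    then have "{t \<in> {0..1}. linepath p q t \<in> open_segment a b} = {}"
      using linepath_in_path[of _ p q] by auto
    then show ?thesis
      by (simp only: openin_empty)
  next
    case False
    \<comment> \<open>The edge runs on the line of the obstacle; in the affine coordinate along that
      line, being strictly inside is an open condition.\<close>
    then have ne: "a \<noteq> b" and "orient a b p = 0" "orient a b q = 0"
      using vis ab by (auto simp: visible_def)
    then obtain i j where ij: "p = a + i *\<^sub>R (b - a)" "q = a + j *\<^sub>R (b - a)"
      using orient_zero_line by metis
    have lp: "linepath p q t = a + ((1 - t) * i + t * j) *\<^sub>R (b - a)" for t
      by (simp add: linepath_def ij algebra_simps)
    have mem: "a + k *\<^sub>R (b - a) \<in> open_segment a b \<longleftrightarrow> k \<in> {0<..<1}" for k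
    proof
      assume "a + k *\<^sub>R (b - a) \<in> open_segment a b"
      then obtain u where "0 < u" "u < 1" "a + k *\<^sub>R (b - a) = a + u *\<^sub>R (b - a)"
        by (auto simp: in_segment algebra_simps)
      then show "k \<in> {0<..<1}"
        using ne by auto
    next
      assume "k \<in> {0<..<1}"
      then show "a + k *\<^sub>R (b - a) \<in> open_segment a b"
        using ne by (auto simp: in_segment algebra_simps intro!: exI[of _ k])
    qed
    have "{t \<in> {0..1}. linepath p q t \<in> open_segment a b}
        = {0..1} \<inter> (\<lambda>t. (1 - t) * i + t * j) -` {0<..<1}"
      unfolding lp mem by blast
    moreover have "open ((\<lambda>t. (1 - t) * i + t * j) -` {0<..<1})"
      by (intro open_vimage continuous_intros)
    ultimately show ?thesis
      by (simp only: openin_open_Int)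
  qed
  then show ?thesis
    using free by (auto simp: avoiding_paths_def obstacle_avoiding_def)
qed

lemma avoiding_join:
  assumes g: "g \<in> avoiding_paths Ob p q" and h: "h \<in> avoiding_paths Ob q r"
  shows "g +++ h \<in> avoiding_paths Ob p r"
proof -
  have ends: "pathfinish g = pathstart h" "g 1 = h 0"
    using g h by (auto simp: avoiding_paths_def pathstart_def pathfinish_def)
  have "compact {t \<in> {0..1}. (g +++ h) t \<notin> U}"
    if "compact {t \<in> {0..1}. g t \<notin> U}" "compact {t \<in> {0..1}. h t \<notin> U}" for U
  proof -
    have "{t \<in> {0..1}. (g +++ h) t \<notin> U}
        = (\<lambda>t. t / 2) ` {t \<in> {0..1}. g t \<notin> U} \<union> (\<lambda>t. (t + 1) / 2) ` {t \<in> {0..1}. h t \<notin> U}"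
      (is "?L = ?A \<union> ?B")
    proof (intro equalityI subsetI)
      fix t
      assume t: "t \<in> ?L"
      show "t \<in> ?A \<union> ?B"
      proof (cases "t \<le> 1 / 2")
        case True
        then have "2 * t \<in> {t \<in> {0..1}. g t \<notin> U}" "t = (2 * t) / 2"
          using t by (auto simp: joinpaths_def)
        then show ?thesis by blast
      next
        case False
        then have "2 * t - 1 \<in> {t \<in> {0..1}. h t \<notin> U}" "t = ((2 * t - 1) + 1) / 2"
          using t by (auto simp: joinpaths_def)
        then show ?thesis by blast
      qed
    next
      fix t
      assume "t \<in> ?A \<union> ?B"
      then show "t \<in> ?L"
        using ends by (auto simp: joinpaths_def add_divide_distrib)
    qed
    moreover have "compact ?A" "compact ?B"
      using that by (auto intro!: compact_continuous_image continuous_intros)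
    ultimately show ?thesis
      by auto
  qed
  then have "openin (top_of_set {0..1}) {t \<in> {0..1}. (g +++ h) t \<in> open_segment a b}"
    if "(a, b) \<in> Ob" for a b
    using g h that unfolding avoiding_paths_def obstacle_avoiding_def openin_iff_compact_complement
    by blast
  then show ?thesis
    using g h ends by (auto simp: avoiding_paths_def obstacle_avoiding_def)
qed

lemma dist_linepath:
  fixes p q :: "'a::real_normed_vector"
  assumes "t \<le> u"
  shows "dist (linepath p q t) (linepath p q u) = (u - t) * dist p q"
proof -
  have "linepath p q t - linepath p q u = (u - t) *\<^sub>R (p - q)"
    by (simp add: linepath_def algebra_simps)
  then show ?thesis
    using assms by (simp add: dist_norm)
qed

text \<open>The potential bounds the length of the path by telescoping, which is stable under joining
  paths, in contrast to estimating a partition that straddles the junction.\<close>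

lemma route_realised:
  assumes Ob: "segment_obstacles Ob" and "route Ob p es q" "p \<in> free_space Ob" "q \<in> free_space Ob"
  shows "\<exists>g \<in> avoiding_paths Ob p q. \<exists>\<phi>. \<phi> 0 = 0 \<and> \<phi> 1 = route_length p es q \<and>
    (\<forall>t u. 0 \<le> t \<longrightarrow> t \<le> u \<longrightarrow> u \<le> 1 \<longrightarrow> dist (g t) (g u) \<le> \<phi> u - \<phi> t)"
  using assms(2,3)
proof (induction es arbitrary: p)
  case Nil
  then show ?case
    using avoiding_linepath[of Ob p q] assms(4)
    by (intro bexI[of _ "linepath p q"] exI[of _ "\<lambda>t. t * dist p q"])
      (auto simp: dist_linepath algebra_simps)
next
  case (Cons e es)
  then have e: "e \<in> free_space Ob" "visible Ob p e" "route Ob e es q"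
    using endpoint_free[OF Ob] by auto
  from Cons.IH[OF e(3,1)] obtain h \<phi> where h: "h \<in> avoiding_paths Ob e q"
    and \<phi>: "\<phi> 0 = 0" "\<phi> 1 = route_length e es q"
    and h\<phi>: "\<And>t u. 0 \<le> t \<Longrightarrow> t \<le> u \<Longrightarrow> u \<le> 1 \<Longrightarrow> dist (h t) (h u) \<le> \<phi> u - \<phi> t"
    by blast
  let ?g = "linepath p e"
  have g: "?g \<in> avoiding_paths Ob p e"
    using avoiding_linepath[of Ob p e] e Cons.prems by blast
  have h0: "h 0 = e"
    using h by (auto simp: avoiding_paths_def pathstart_def)
  define \<psi> where "\<psi> t = (if t \<le> 1 / 2 then 2 * t * dist p e else dist p e + \<phi> (2 * t - 1))" for t
  have "dist ((?g +++ h) t) ((?g +++ h) u) \<le> \<psi> u - \<psi> t" if tu: "0 \<le> t" "t \<le> u" "u \<le> 1" for t u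
  proof -
    consider "u \<le> 1 / 2" | "t \<le> 1 / 2" "u > 1 / 2" | "t > 1 / 2"
      using tu by linarith
    then show ?thesis
    proof cases
      case 1
      then show ?thesis
        using dist_linepath[of "2 * t" "2 * u" p e] tu by (simp add: joinpaths_def \<psi>_def algebra_simps)
    next
      case 2
      have "dist (?g (2 * t)) (h (2 * u - 1)) \<le> dist (?g (2 * t)) (?g 1) + dist (h 0) (h (2 * u - 1))"
        using dist_triangle[of "?g (2 * t)" "h (2 * u - 1)" e] h0 by (simp add: linepath_1')
      also have "\<dots> \<le> (1 - 2 * t) * dist p e + \<phi> (2 * u - 1)"
        using dist_linepath[of "2 * t" 1 p e] h\<phi>[of 0 "2 * u - 1"] 2 tu \<phi>(1) by simp
      finally show ?thesis
        using 2 by (simp add: joinpaths_def \<psi>_def algebra_simps)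
    next
      case 3
      then show ?thesis
        using h\<phi>[of "2 * t - 1" "2 * u - 1"] tu by (simp add: joinpaths_def \<psi>_def)
    qed
  qed
  moreover have "\<psi> 0 = 0" "\<psi> 1 = route_length p (e # es) q"
    by (simp_all add: \<psi>_def \<phi>)
  ultimately show ?case
    using avoiding_join[OF g h] by blast
qed

lemma obstacle_dist_le_route:
  assumes "segment_obstacles Ob" "route Ob p es q" "p \<in> free_space Ob" "q \<in> free_space Ob"
  shows "\<exists>g \<in> avoiding_paths Ob p q. path_length g \<le> ereal (route_length p es q)"
    and "obstacle_dist Ob p q \<le> ereal (route_length p es q)"
proof -
  obtain g \<phi> where g: "g \<in> avoiding_paths Ob p q"
    and \<phi>: "\<phi> 0 = 0" "\<phi> 1 = route_length p es q"
    and g\<phi>: "\<And>t u. 0 \<le> t \<Longrightarrow> t \<le> u \<Longrightarrow> u \<le> 1 \<Longrightarrow> dist (g t) (g u) \<le> \<phi> u - \<phi> t"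
    using route_realised[OF assms] by blast
  have "path_length g \<le> ereal (route_length p es q)"
    using path_length_le_potential[of g \<phi>, OF g\<phi>] \<phi> by simp
  with g show "\<exists>g \<in> avoiding_paths Ob p q. path_length g \<le> ereal (route_length p es q)"
    by blast
  then show "obstacle_dist Ob p q \<le> ereal (route_length p es q)"
    unfolding obstacle_dist_def by (auto intro: INF_lower2)
qed

section \<open>Existence of shortest paths\<close>

text \<open>Near \<open>x\<close> an obstacle is either out of reach or has \<open>x\<close> as an
  end; in the latter case a segment from \<open>x\<close> that enters it runs on its line.\<close>

lemma eventually_visible_free:
  assumes "finite Ob" "x \<in> free_space Ob"
  shows "\<forall>\<^sub>F y in nhds x. visible Ob x y"
proof -
  have "\<forall>\<^sub>F y in nhds x. closed_segment x y \<inter> open_segment a b \<noteq> {} \<longrightarrow>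
      orient a b x = 0 \<and> orient a b y = 0" if ab: "(a, b) \<in> Ob" for a b
  proof (cases "x \<in> closed_segment a b")
    case False
    then obtain r where r: "r > 0" "ball x r \<subseteq> - closed_segment a b"
      using open_contains_ball[of "- closed_segment a b"] by auto
    have "\<forall>\<^sub>F y in nhds x. y \<in> ball x r"
      using r by (intro eventually_nhds_in_open) auto
    then show ?thesis
    proof (rule eventually_mono)
      fix y
      assume "y \<in> ball x r"
      then have "closed_segment x y \<subseteq> ball x r"
        using r(1) by (intro closed_segment_subset) auto
      moreover have "open_segment a b \<subseteq> closed_segment a b"
        by (auto simp: open_segment_def)
      ultimately show "closed_segment x y \<inter> open_segment a b \<noteq> {} \<longrightarrow>
          orient a b x = 0 \<and> orient a b y = 0"
        using r(2) by blast
    qed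
  next
    case True
    then have x: "x = a \<or> x = b"
      using assms(2) ab by (auto simp: free_space_def open_segment_def)
    have "orient a b y = 0" if w: "w \<in> closed_segment x y" "w \<in> open_segment a b" for y w
    proof -
      have "orient a b w = 0"
        using orient_zero_on_segment[of a b a b w] w(2) by (auto simp: open_segment_def)
      moreover have "orient a b x = 0"
        using x by auto
      moreover have "x \<noteq> w"
        using w(2) x by (auto simp: open_segment_def)
      moreover have "orient x w y = 0"
        using orient_zero_on_segment[of x y x y w] w(1) by (simp add: orient_def algebra_simps)
      ultimately show ?thesis
        using orient_zero_extend by blast
    qed
    then show ?thesis
      using x by (auto intro!: always_eventually)
  qed
  then have "\<forall>\<^sub>F y in nhds x. \<forall>ab\<in>Ob. case ab of (a, b) \<Rightarrow> closed_segment x y \<inter> open_segment a b \<noteq> {} \<longrightarrow>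
      orient a b x = 0 \<and> orient a b y = 0"
    using assms(1) by (intro eventually_ball_finite) auto
  then show ?thesis
    by (simp add: visible_def)
qed

lemma visible_along_obstacle:
  assumes Ob: "segment_obstacles Ob" and ab: "(a, b) \<in> Ob"
    and xy: "x \<in> open_segment a b" "y \<in> open_segment a b"
  shows "visible Ob x y"
  unfolding visible_def
proof (clarify)
  fix c d
  assume cd: "(c, d) \<in> Ob" and ne: "closed_segment x y \<inter> open_segment c d \<noteq> {}"
  have "closed_segment x y \<subseteq> closed_segment a b"
    using xy by (simp add: subset_closed_segment open_segment_def)
  moreover have "open_segment c d \<subseteq> closed_segment c d"
    by (auto simp: open_segment_def)
  ultimately have "closed_segment a b \<inter> closed_segment c d \<noteq> {}"
    using ne by blast
  then have "(c, d) = (a, b)"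
    using Ob ab cd unfolding segment_obstacles_def disjoint_family_on_def by fastforce
  then show "orient c d x = 0 \<and> orient c d y = 0"
    using xy orient_zero_on_segment[of a b a b] by (auto simp: open_segment_def)
qed

text \<open>At a free point this is continuity with \<open>eventually_visible_free\<close>. Inside
  an obstacle it is the openness clause of \<open>obstacle_avoiding\<close>: the path stays in that
  obstacle for a while, and its interior points see each other.\<close>

lemma locally_visible:
  assumes Ob: "segment_obstacles Ob" and g: "obstacle_avoiding Ob g" and t: "t \<in> {0..1}"
  shows "\<exists>d>0. \<forall>u\<in>{0..1}. \<bar>u - t\<bar> < d \<longrightarrow> visible Ob (g t) (g u)"
proof (cases "g t \<in> free_space Ob")
  case True
  have "continuous (at t within {0..1}) g"
    using g t by (auto simp: obstacle_avoiding_def path_def continuous_on_eq_continuous_within)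
  then have "(g \<longlongrightarrow> g t) (at t within {0..1})"
    by (simp add: continuous_within)
  from filterlim_iff[THEN iffD1, OF this, rule_format, OF eventually_visible_free]
  have "\<forall>\<^sub>F u in at t within {0..1}. visible Ob (g t) (g u)"
    using Ob True by (simp add: segment_obstacles_def)
  then obtain d where "d > 0" "\<And>u. u \<in> {0..1} \<Longrightarrow> u \<noteq> t \<Longrightarrow> dist u t < d \<Longrightarrow> visible Ob (g t) (g u)"
    unfolding eventually_at by blast
  moreover have "visible Ob (g t) (g t)"
    using eventually_nhds_x_imp_x[OF eventually_visible_free] Ob True
    by (simp add: segment_obstacles_def)
  ultimately show ?thesis
    by (metis dist_real_def)
next
  case False
  then obtain a b where ab: "(a, b) \<in> Ob" "g t \<in> open_segment a b"
    by (auto simp: free_space_def)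
  then have "openin (top_of_set {0..1}) {t \<in> {0..1}. g t \<in> open_segment a b}"
    using g by (auto simp: obstacle_avoiding_def)
  then obtain d where "d > 0" "\<And>u. u \<in> {0..1} \<Longrightarrow> dist u t < d \<Longrightarrow> g u \<in> open_segment a b"
    using ab t unfolding openin_euclidean_subtopology_iff by blast
  then show ?thesis
    using visible_along_obstacle[OF Ob ab] by (auto simp: dist_real_def)
qed

lemma sorted_append_intervals:
  assumes "sorted ts" "sorted us" "set ts \<subseteq> {a..b::real}" "set us \<subseteq> {b..c}"
  shows "sorted (ts @ us)"
  using assms by (force simp: sorted_append)

text \<open>Bisection by \<open>Bolzano\<close> replaces the choice of a fine partition: the claim
  passes to the union of adjacent intervals and holds on short ones. Speaking of every route that
  arrives at \<open>g a\<close> is what makes it composable.\<close>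

lemma route_along_path:
  assumes Ob: "segment_obstacles Ob" and s: "s \<in> free_space Ob"
    and g: "obstacle_avoiding Ob g" and ab: "0 \<le> a" "a \<le> b" "b \<le> 1"
  shows "\<exists>ts. sorted ts \<and> set ts \<subseteq> {a..b} \<and>
    (\<forall>es. route Ob s es (g a) \<longrightarrow> (\<exists>fs. route Ob s fs (g b) \<and>
       route_length s fs (g b) \<le> route_length s es (g a) + polygon_length g ts))"
proof -
  define P where "P a b \<longleftrightarrow> 0 \<le> a \<and> b \<le> 1 \<longrightarrow> (\<exists>ts. sorted ts \<and> set ts \<subseteq> {a..b} \<and>
    (\<forall>es. route Ob s es (g a) \<longrightarrow> (\<exists>fs. route Ob s fs (g b) \<and>
       route_length s fs (g b) \<le> route_length s es (g a) + polygon_length g ts)))" for a b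
  from ab(2) have "P a b"
  proof (induction rule: Bolzano)
    case (trans a b c)
    show ?case
      unfolding P_def
    proof (intro impI)
      assume ac: "0 \<le> a \<and> c \<le> 1"
      obtain ts where ts: "sorted ts" "set ts \<subseteq> {a..b}"
        "\<And>es. route Ob s es (g a) \<Longrightarrow> (\<exists>fs. route Ob s fs (g b) \<and>
           route_length s fs (g b) \<le> route_length s es (g a) + polygon_length g ts)"
        using trans ac unfolding P_def by force
      obtain us where us: "sorted us" "set us \<subseteq> {b..c}"
        "\<And>es. route Ob s es (g b) \<Longrightarrow> (\<exists>fs. route Ob s fs (g c) \<and>
           route_length s fs (g c) \<le> route_length s es (g b) + polygon_length g us)"
        using trans ac unfolding P_def by force
      have "sorted (ts @ us)"
        using sorted_append_intervals ts us by blast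
      moreover have "set (ts @ us) \<subseteq> {a..c}"
        using ts us trans by fastforce
      moreover have "\<exists>fs. route Ob s fs (g c) \<and>
          route_length s fs (g c) \<le> route_length s es (g a) + polygon_length g (ts @ us)"
        if es: "route Ob s es (g a)" for es
      proof -
        obtain fs where fs: "route Ob s fs (g b)"
          "route_length s fs (g b) \<le> route_length s es (g a) + polygon_length g ts"
          using ts(3)[OF es] by blast
        obtain hs where "route Ob s hs (g c)"
          "route_length s hs (g c) \<le> route_length s fs (g b) + polygon_length g us"
          using us(3)[OF fs(1)] by blast
        then show ?thesis
          using fs(2) polygon_length_append[of g ts us] by (intro exI[of _ hs]) auto
      qed
      ultimately show "\<exists>ts. sorted ts \<and> set ts \<subseteq> {a..c} \<and>
        (\<forall>es. route Ob s es (g a) \<longrightarrow> (\<exists>fs. route Ob s fs (g c) \<and>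
           route_length s fs (g c) \<le> route_length s es (g a) + polygon_length g ts))"
        by blast
    qed
  next
    case (local x)
    then have x01: "x \<in> {0..1}"
      using ab by auto
    then obtain d where d: "d > 0" "\<And>u. u \<in> {0..1} \<Longrightarrow> \<bar>u - x\<bar> < d \<Longrightarrow> visible Ob (g x) (g u)"
      using locally_visible[OF Ob g] by blast
    have "P a b" if "a \<le> x" "x \<le> b" "b - a < d" for a b
      unfolding P_def
    \<comment> \<open>The point \<open>x\<close> is sampled too, since local visibility is known
      only from \<open>g x\<close>.\<close>
    proof (intro impI exI[of _ "[a, x, b]"] conjI allI)
      fix es
      assume ab: "0 \<le> a \<and> b \<le> 1" and es: "route Ob s es (g a)"
      have "visible Ob (g a) (g x)" "visible Ob (g x) (g b)"
        using d(2)[of a] d(2)[of b] ab that visible_sym by auto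
      then have "route Ob (g a) [] (g x)" "route Ob (g x) [] (g b)"
        by simp_all
      from route_concat[OF Ob s es this(1)] obtain fs where fs: "route Ob s fs (g x)"
        "route_length s fs (g x) \<le> route_length s es (g a) + dist (g a) (g x)"
        by auto
      from route_concat[OF Ob s fs(1) \<open>route Ob (g x) [] (g b)\<close>]
      obtain hs where "route Ob s hs (g b)"
        "route_length s hs (g b) \<le> route_length s fs (g x) + dist (g x) (g b)"
        by auto
      then show "\<exists>fs. route Ob s fs (g b) \<and>
          route_length s fs (g b) \<le> route_length s es (g a) + polygon_length g [a, x, b]"
        using fs(2) by (intro exI[of _ hs]) auto
    qed (use that in auto)
    then show ?case
      using d(1) by blast
  qed
  then show ?thesis
    using ab by (simp add: P_def)
qed

lemma visible_self: "x \<in> free_space Ob \<Longrightarrow> visible Ob x x"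
  by (auto simp: visible_def free_space_def)

lemma route_shorter_than_path:
  assumes Ob: "segment_obstacles Ob" and g: "g \<in> avoiding_paths Ob s p" and t: "0 \<le> t" "t \<le> 1"
  shows "\<exists>ts es. sorted ts \<and> set ts \<subseteq> {0..t} \<and> route Ob s es (g t) \<and>
    route_length s es (g t) \<le> polygon_length g ts"
proof -
  have g': "obstacle_avoiding Ob g" "g 0 = s" "s \<in> free_space Ob"
    using g by (auto simp: avoiding_paths_def obstacle_avoiding_def pathstart_def)
  have "route Ob s [] (g 0)"
    using visible_self[OF g'(3)] by (simp add: g'(2))
  with route_along_path[OF Ob g'(3,1) order_refl t]
  obtain ts fs where "sorted ts" "set ts \<subseteq> {0..t}" "route Ob s fs (g t)"
    "route_length s fs (g t) \<le> route_length s [] (g 0) + polygon_length g ts"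
    by blast
  then show ?thesis
    using g'(2) by auto
qed

text \<open>Cutting out cycles leaves finitely many candidates for a minimum.\<close>

lemma distinct_route:
  assumes "route Ob s es p"
  shows "\<exists>fs. distinct fs \<and> route Ob s fs p \<and> route_length s fs p \<le> route_length s es p"
  using assms
proof (induction "length es" arbitrary: es rule: less_induct)
  case less
  show ?case
  proof (cases "distinct es")
    case False
    then obtain xs ys zs y where es: "es = xs @ [y] @ ys @ [y] @ zs"
      using not_distinct_decomp by blast
    then have "es = xs @ y # (ys @ y # zs)" by simp
    then have "route Ob s (xs @ y # zs) p"
      and "route_length s (xs @ y # zs) p \<le> route_length s es p"
      using less.prems route_length_nonneg[of y ys y]
      by (auto simp: route_append route_length_append)
    then show ?thesis
      using less.hyps[of "xs @ y # zs"] es by fastforce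
  qed (use less.prems in blast)
qed

text \<open>Every avoiding path dominates a route without repeated bends; the best of these finitely
  many routes attains the infimum.\<close>

lemma obstacle_dist_attained:
  assumes Ob: "segment_obstacles Ob" and g: "g \<in> avoiding_paths Ob s p"
  obtains es where "route Ob s es p" "obstacle_dist Ob s p = ereal (route_length s es p)"
proof -
  have free: "s \<in> free_space Ob" "p \<in> free_space Ob"
    using g by (auto simp: avoiding_paths_def obstacle_avoiding_def)
  let ?R = "{es. distinct es \<and> route Ob s es p}"
  have short: "\<exists>es\<in>?R. ereal (route_length s es p) \<le> path_length h"
    if h: "h \<in> avoiding_paths Ob s p" for h
  proof -
    have "h 1 = p"
      using h by (auto simp: avoiding_paths_def pathfinish_def)
    then obtain ts es where ts: "sorted ts" "set ts \<subseteq> {0..1}" "route Ob s es p"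
      "route_length s es p \<le> polygon_length h ts"
      using route_shorter_than_path[OF Ob h, of 1] by auto
    obtain fs where "fs \<in> ?R" "route_length s fs p \<le> route_length s es p"
      using distinct_route[OF ts(3)] by blast
    moreover have "ereal (route_length s es p) \<le> path_length h"
      using polygon_length_le_path_length[OF ts(1,2), of h] ts(4) order_trans ereal_less_eq(3) by blast
    ultimately show ?thesis
      by (meson ereal_less_eq(3) order_trans)
  qed
  have "finite (obstacle_endpoints Ob)"
    using Ob by (auto simp: segment_obstacles_def obstacle_endpoints_def)
  then have fin: "finite ?R"
    by (rule finite_subset[rotated, OF finite_subset_distinct]) (auto dest: route_endpoints)
  have ne: "?R \<noteq> {}"
    using short[OF g] by blast
  obtain es where es: "es \<in> ?R" "\<And>fs. fs \<in> ?R \<Longrightarrow> route_length s es p \<le> route_length s fs p"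
    using arg_min_if_finite(1)[OF fin ne] arg_min_least[OF fin ne, of _ "\<lambda>es. route_length s es p"]
    by blast
  have "obstacle_dist Ob s p = ereal (route_length s es p)"
  proof (rule antisym)
    show "obstacle_dist Ob s p \<le> ereal (route_length s es p)"
      using obstacle_dist_le_route(2)[OF Ob _ free] es by blast
    show "ereal (route_length s es p) \<le> obstacle_dist Ob s p"
      unfolding obstacle_dist_def
      by (rule INF_greatest) (meson short es(2) ereal_less_eq(3) order_trans)
  qed
  then show ?thesis
    using that es by blast
qed

lemma shortest_path_exists:
  assumes Ob: "segment_obstacles Ob" and g: "g \<in> avoiding_paths Ob s p"
  shows "\<exists>h. shortest_path Ob s p h"
proof -
  have free: "s \<in> free_space Ob" "p \<in> free_space Ob"
    using g by (auto simp: avoiding_paths_def obstacle_avoiding_def)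
  obtain es where es: "route Ob s es p" "obstacle_dist Ob s p = ereal (route_length s es p)"
    using obstacle_dist_attained[OF Ob g] .
  obtain h where h: "h \<in> avoiding_paths Ob s p" "path_length h \<le> ereal (route_length s es p)"
    using obstacle_dist_le_route(1)[OF Ob es(1) free] by blast
  then have "obstacle_dist Ob s p \<le> path_length h"
    unfolding obstacle_dist_def by (auto intro: INF_lower)
  then show ?thesis
    using h es(2) by (auto simp: shortest_path_def intro: antisym)
qed

text \<open>One visiting time is chosen per endpoint and the times are sorted; for a path that
  revisits endpoints the sequence may depend on the choice.\<close>

lemma passes_through_exists:
  assumes "finite Ob"
  shows "\<exists>es. passes_through Ob g es"
proof -
  define E where "E = obstacle_endpoints Ob \<inter> path_image g - {pathstart g, pathfinish g}"
  have "\<forall>e\<in>E. \<exists>t\<in>{0..1}. g t = e"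
    by (auto simp: E_def path_image_def)
  then obtain \<tau> where \<tau>: "\<And>e. e \<in> E \<Longrightarrow> \<tau> e \<in> {0..1} \<and> g (\<tau> e) = e"
    by metis
  have fin: "finite (\<tau> ` E)"
    using assms by (auto simp: E_def obstacle_endpoints_def)
  define ts where "ts = sorted_list_of_set (\<tau> ` E)"
  have ts: "set ts = \<tau> ` E" "sorted_wrt (<) ts"
    using fin by (auto simp: ts_def)
  have "set (map g ts) = E"
    using \<tau> by (force simp: ts)
  moreover have "distinct (map g ts)"
    using \<tau> fin by (auto simp: distinct_map ts ts_def inj_on_def)
  moreover have "set ts \<subseteq> {0..1}"
    using \<tau> by (auto simp: ts)
  ultimately show ?thesis
    unfolding passes_through_def E_def using ts(2) by blast
qed

section \<open>Shortest paths between endpoints are straight\<close>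

text \<open>Replacing the middle piece by \<open>es\<close> and the rest of the path by routes no
  longer than its samples gives a route from \<open>s\<close> to \<open>p\<close>; minimality
  compares it with all samples together, and the outer parts cancel. Samples are used instead of
  subpaths because \<open>g a\<close> and \<open>g b\<close> may lie inside an obstacle, where no
  avoiding path starts or ends.\<close>

lemma shortest_path_piece:
  assumes Ob: "segment_obstacles Ob" and g: "shortest_path Ob s p g"
    and ab: "0 \<le> a" "a \<le> b" "b \<le> 1"
    and es: "route Ob (g a) es (g b)" and ts: "sorted ts" "set ts \<subseteq> {a..b}"
  shows "polygon_length g ts \<le> route_length (g a) es (g b)"
proof -
  have av: "g \<in> avoiding_paths Ob s p" and len: "path_length g = obstacle_dist Ob s p"
    using g by (auto simp: shortest_path_def)
  then have g': "obstacle_avoiding Ob g" "s \<in> free_space Ob" "p \<in> free_space Ob" "g 1 = p"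
    by (auto simp: avoiding_paths_def obstacle_avoiding_def pathfinish_def)
  have a1: "a \<le> 1" and b0: "0 \<le> b"
    using ab by auto
  obtain us fs where us: "sorted us" "set us \<subseteq> {0..a}" "route Ob s fs (g a)"
    "route_length s fs (g a) \<le> polygon_length g us"
    using route_shorter_than_path[OF Ob av ab(1) a1] by blast
  obtain hs where hs: "route Ob s hs (g b)"
    "route_length s hs (g b) \<le> route_length s fs (g a) + route_length (g a) es (g b)"
    using route_concat[OF Ob g'(2) us(3) es] by blast
  obtain vs ks where vs: "sorted vs" "set vs \<subseteq> {b..1}" "route Ob s ks p"
    "route_length s ks p \<le> route_length s hs (g b) + polygon_length g vs"
    using route_along_path[OF Ob g'(2,1) b0 ab(3) order_refl] hs(1) g'(4) by auto
  have "sorted (ts @ vs)"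
    using sorted_append_intervals[OF ts(1) vs(1) ts(2) vs(2)] .
  moreover have tvs: "set (ts @ vs) \<subseteq> {a..1}"
    using ts(2) vs(2) ab by fastforce
  ultimately have "sorted (us @ ts @ vs)"
    using sorted_append_intervals[OF us(1) _ us(2)] by blast
  moreover have "set (us @ ts @ vs) \<subseteq> {0..1}"
    using us(2) tvs ab by fastforce
  ultimately have "ereal (polygon_length g (us @ ts @ vs)) \<le> obstacle_dist Ob s p"
    using polygon_length_le_path_length[of "us @ ts @ vs" g] len by simp
  also have "\<dots> \<le> ereal (route_length s ks p)"
    by (rule obstacle_dist_le_route(2)[OF Ob vs(3) g'(2,3)])
  finally have "polygon_length g (us @ ts @ vs) \<le> route_length s ks p"
    by simp
  then show ?thesis
    using us(4) hs(2) vs(4) polygon_length_append[of g us "ts @ vs"] polygon_length_append[of g ts vs]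
    by linarith
qed

text \<open>Equality in the triangle inequality keeps the piece on the segment, and the intermediate
  value theorem for the distance from \<open>g a\<close> fills it. Endpoints on a sight line are
  thus visited by the path.\<close>

lemma shortest_path_piece_covers_segment:
  assumes Ob: "segment_obstacles Ob" and g: "shortest_path Ob s p g"
    and ab: "0 \<le> a" "a \<le> b" "b \<le> 1"
    and vis: "visible Ob (g a) (g b)"
  shows "closed_segment (g a) (g b) \<subseteq> g ` {a..b}"
proof -
  have "path g"
    using g by (auto simp: shortest_path_def avoiding_paths_def obstacle_avoiding_def)
  then have cont: "continuous_on {a..b} g"
    using ab by (auto simp: path_def intro: continuous_on_subset)
  have on: "g ` {a..b} \<subseteq> closed_segment (g a) (g b)"
  proof clarify
    fix t
    assume "t \<in> {a..b}"
    then have "polygon_length g [a, t, b] \<le> route_length (g a) [] (g b)"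
      using vis ab by (intro shortest_path_piece[OF Ob g]) auto
    then show "g t \<in> closed_segment (g a) (g b)"
      using dist_triangle[of "g a" "g b" "g t"]
      by (simp add: between_mem_segment[symmetric] between)
  qed
  show ?thesis
  proof
    fix x
    assume x: "x \<in> closed_segment (g a) (g b)"
    let ?D = "dist (g a) (g b)"
    have dist: "dist (g a) ((1 - k) *\<^sub>R g a + k *\<^sub>R g b) = k * ?D" if "0 \<le> k" for k
    proof -
      have "g a - ((1 - k) *\<^sub>R g a + k *\<^sub>R g b) = k *\<^sub>R (g a - g b)"
        by (simp add: algebra_simps)
      then show ?thesis
        using that by (simp add: dist_norm)
    qed
    obtain j where j: "0 \<le> j" "j \<le> 1" "x = (1 - j) *\<^sub>R g a + j *\<^sub>R g b"
      using x by (auto simp: in_segment)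
    have "continuous_on {a..b} (\<lambda>t. dist (g a) (g t))"
      by (intro continuous_intros cont)
    moreover have "0 \<le> j * ?D" "j * ?D \<le> ?D"
      using j by (auto intro: mult_left_le_one_le)
    ultimately obtain t where t: "a \<le> t" "t \<le> b" "dist (g a) (g t) = j * ?D"
      using IVT'[of "\<lambda>t. dist (g a) (g t)" a "j * ?D" b] ab by auto
    have "g t \<in> closed_segment (g a) (g b)"
      using on t by auto
    then obtain i where i: "0 \<le> i" "g t = (1 - i) *\<^sub>R g a + i *\<^sub>R g b"
      by (auto simp: in_segment)
    have "i * ?D = j * ?D"
      using t(3) dist[OF i(1)] by (simp add: i(2))
    then have "g t = x"
      unfolding i(2) j(3) by (cases "g a = g b") (auto simp flip: scaleR_add_left)
    then show "x \<in> g ` {a..b}"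
      using t by auto
  qed
qed

text \<open>\<open>Bolzano\<close> again, with sight from \<open>g a\<close> as the property carried
  forward. If it were lost, the sweep would yield a strictly shorter route, or an endpoint on the
  current sight line; that endpoint is on the path, hence equals \<open>p\<close>, which would then
  be visible.\<close>

lemma shortest_path_piece_visible:
  assumes Ob: "segment_obstacles Ob" and g: "shortest_path Ob s p g"
    and a: "0 \<le> a" "a \<le> 1" "g a \<in> free_space Ob"
    and ends: "\<And>u. a \<le> u \<Longrightarrow> u \<le> 1 \<Longrightarrow> g u \<in> obstacle_endpoints Ob \<Longrightarrow> g u = g a \<or> g u = p"
  shows "visible Ob (g a) p"
proof (rule ccontr)
  assume nvis: "\<not> visible Ob (g a) p"
  have g': "obstacle_avoiding Ob g" "g 1 = p"
    using g by (auto simp: shortest_path_def avoiding_paths_def pathfinish_def)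
  have step: "visible Ob (g a) (g v)"
    if uv: "a \<le> u" "u \<le> v" "v \<le> 1" and vis: "visible Ob (g a) (g u)" "visible Ob (g u) (g v)" for u v
  proof (rule ccontr)
    assume "\<not> ?thesis"
    from blocked_triangle_cases[OF Ob a(3) vis this] consider
      e where "e \<in> obstacle_endpoints Ob" "e \<noteq> g a" "e \<in> closed_segment (g a) (g u)"
      | es where "route Ob (g a) es (g v)"
        "route_length (g a) es (g v) < dist (g a) (g u) + dist (g u) (g v)"
      by blast
    then show False
    proof cases
      case 1
      have "e \<in> g ` {a..u}"
        using shortest_path_piece_covers_segment[OF Ob g a(1) uv(1) _ vis(1)] 1(3) uv by auto
      then have "e = p"
        using ends 1 uv by fastforce
      then show False
        using nvis visible_subsegment[OF vis(1)] 1(3) by simp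
    next
      case 2
      have "polygon_length g [a, u, v] \<le> route_length (g a) es (g v)"
        using uv a(1) by (intro shortest_path_piece[OF Ob g _ _ _ 2(1)]) auto
      then show False
        using 2(2) by simp
    qed
  qed
  have "a \<le> a \<and> 1 \<le> (1::real) \<longrightarrow> visible Ob (g a) (g a) \<longrightarrow> visible Ob (g a) (g 1)"
    using a(2)
  proof (induction rule: Bolzano[where P = "\<lambda>u v. a \<le> u \<and> v \<le> 1 \<longrightarrow>
      visible Ob (g a) (g u) \<longrightarrow> visible Ob (g a) (g v)"])
    case (local x)
    then obtain d where d: "d > 0" "\<And>u. u \<in> {0..1} \<Longrightarrow> \<bar>u - x\<bar> < d \<Longrightarrow> visible Ob (g x) (g u)"
      using locally_visible[OF Ob g'(1), of x] a by auto
    have "visible Ob (g a) (g v)"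
      if uv: "u \<le> x" "x \<le> v" "v - u < d" "a \<le> u" "v \<le> 1" "visible Ob (g a) (g u)" for u v
    proof -
      have "visible Ob (g u) (g x)" "visible Ob (g x) (g v)"
        using d(2)[of u] d(2)[of v] uv a visible_sym by auto
      then show ?thesis
        using step[of u x] step[of x v] uv by auto
    qed
    then show ?case
      using d(1) by blast
  qed auto
  then show False
    using visible_self[OF a(3)] nvis g'(2) by simp
qed

text \<open>A closed loop could be replaced by staying at \<open>g a\<close>, a route of length
  0.\<close>

lemma shortest_path_no_return:
  assumes Ob: "segment_obstacles Ob" and g: "shortest_path Ob s p g"
    and abc: "0 \<le> a" "a \<le> b" "b \<le> c" "c \<le> 1"
    and eq: "g c = g a" "g a \<in> free_space Ob"
  shows "g b = g a"
proof -
  have "polygon_length g [a, b, c] \<le> route_length (g a) [] (g c)"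
    using abc visible_self[OF eq(2)] eq(1) by (intro shortest_path_piece[OF Ob g]) auto
  then show ?thesis
    using eq(1) by (simp add: dist_commute)
qed

section \<open>Distances through an intermediate point and the control point\<close>

text \<open>The two halves of the distance formula through \<open>g t\<close>. The first samples the
  path at \<open>t\<close> and at 1 and also shows that the distance to \<open>g t\<close> is
  finite; the second prolongs an optimal route by one edge.\<close>

lemma obstacle_dist_via:
  assumes Ob: "segment_obstacles Ob" and g: "g \<in> avoiding_paths Ob s p"
    and t: "0 \<le> t" "t \<le> 1" "g t \<in> free_space Ob"
  shows "\<exists>d. obstacle_dist Ob s (g t) = ereal d \<and> ereal (d + dist (g t) p) \<le> path_length g"
    and "visible Ob (g t) p \<Longrightarrow>
      obstacle_dist Ob s p \<le> obstacle_dist Ob s (g t) + ereal (dist (g t) p)"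
proof -
  have g': "s \<in> free_space Ob" "p \<in> free_space Ob" "g 1 = p"
    using g by (auto simp: avoiding_paths_def obstacle_avoiding_def pathfinish_def)
  obtain ts es where ts: "sorted ts" "set ts \<subseteq> {0..t}" "route Ob s es (g t)"
    "route_length s es (g t) \<le> polygon_length g ts"
    using route_shorter_than_path[OF Ob g t(1,2)] by blast
  obtain h where "h \<in> avoiding_paths Ob s (g t)"
    using obstacle_dist_le_route(1)[OF Ob ts(3) g'(1) t(3)] by blast
  then obtain fs where fs: "route Ob s fs (g t)"
    "obstacle_dist Ob s (g t) = ereal (route_length s fs (g t))"
    using obstacle_dist_attained[OF Ob] by blast
  have "route_length s fs (g t) \<le> route_length s es (g t)"
    using obstacle_dist_le_route(2)[OF Ob ts(3) g'(1) t(3)] fs(2) by simp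
  then have "route_length s fs (g t) + dist (g t) p \<le> polygon_length g (ts @ [t, 1])"
    using polygon_length_append[of g ts "[t, 1]"] ts(4) g'(3) by simp
  moreover have "sorted (ts @ [t, 1])"
    using sorted_append_intervals[OF ts(1) _ ts(2), of "[t, 1]" 1] t by simp
  moreover have "set (ts @ [t, 1]) \<subseteq> {0..1}"
    using ts(2) t by auto
  ultimately have "ereal (route_length s fs (g t) + dist (g t) p) \<le> path_length g"
    using polygon_length_le_path_length ereal_less_eq(3) order_trans by blast
  then show "\<exists>d. obstacle_dist Ob s (g t) = ereal d \<and> ereal (d + dist (g t) p) \<le> path_length g"
    using fs(2) by blast
  assume "visible Ob (g t) p"
  then obtain hs where hs: "route Ob s hs p"
    "route_length s hs p \<le> route_length s fs (g t) + dist (g t) p"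
    using route_extend[OF Ob g'(1) fs(1)] by blast
  then show "obstacle_dist Ob s p \<le> obstacle_dist Ob s (g t) + ereal (dist (g t) p)"
    using obstacle_dist_le_route(2)[OF Ob hs(1) g'(1,2)] unfolding fs(2) plus_ereal.simps
    by (meson ereal_less_eq(3) order_trans)
qed

text \<open>The control point is the last recorded endpoint, so the path meets no new endpoint
  afterwards and \<open>shortest_path_piece_visible\<close> applies.\<close>

lemma control_point_time:
  assumes Ob: "segment_obstacles Ob" and g: "shortest_path Ob s p g"
    and es: "passes_through Ob g es" "es \<noteq> []"
  obtains t where "0 \<le> t" "t \<le> 1" "g t = control_point es" "g t \<in> free_space Ob" "g t \<noteq> p"
    "visible Ob (g t) p"
proof -
  have g': "g \<in> avoiding_paths Ob s p" "pathstart g = s" "pathfinish g = p" "g 0 = s" "g 1 = p"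
    "s \<in> free_space Ob"
    using g by (auto simp: shortest_path_def avoiding_paths_def obstacle_avoiding_def
        pathstart_def pathfinish_def)
  obtain ts where ts: "sorted_wrt (<) ts" "set ts \<subseteq> {0..1}" "es = map g ts"
    and set_es: "set es = obstacle_endpoints Ob \<inter> path_image g - {s, p}"
    using es(1) unfolding passes_through_def g' by blast
  have ne: "ts \<noteq> []"
    using es(2) ts(3) by simp
  define t where "t = last ts"
  have t: "t \<in> set ts" "t \<in> {0..1}"
    using ne ts(2) last_in_set[OF ne] unfolding t_def by blast+
  have gt: "g t = control_point es"
    using ne by (simp add: control_point_def ts(3) t_def last_map)
  have "g t \<in> set es"
    using t ts(3) by simp
  then have end_t: "g t \<in> obstacle_endpoints Ob" "g t \<noteq> s" "g t \<noteq> p"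
    using set_es by auto
  have le: "u \<le> t" if "u \<in> set ts" for u
  proof -
    have "ts = butlast ts @ [t]"
      using ne by (simp add: t_def)
    then show ?thesis
      using that ts(1) sorted_wrt_append[of "(<)" "butlast ts" "[t]"] by (metis Un_iff empty_iff
          empty_set less_imp_le list.set_intros(1) order_refl set_ConsD set_append)
  qed
  have "visible Ob (g t) p"
  proof (rule shortest_path_piece_visible[OF Ob g])
    show "g t \<in> free_space Ob"
      using endpoint_free[OF Ob end_t(1)] .
    fix u
    assume u: "t \<le> u" "u \<le> 1" "g u \<in> obstacle_endpoints Ob"
    show "g u = g t \<or> g u = p"
    proof (rule ccontr)
      assume neq: "\<not> ?thesis"
      \<comment> \<open>\<open>ts\<close> records one time per endpoint, so \<open>g u\<close> might
        be visited again after \<open>t\<close>. It then also occurs at some \<open>w\<close> no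
        later than \<open>t\<close>, at time 0 if it is the start, which \<open>es\<close> omits; by
        \<open>shortest_path_no_return\<close> the control point in between would coincide with
        it.\<close>
      have "\<exists>w. 0 \<le> w \<and> w \<le> t \<and> g w = g u"
      proof (cases "g u = s")
        case True
        then show ?thesis
          using g' t by (intro exI[of _ 0]) auto
      next
        case False
        have "g u \<in> path_image g"
          using u t by (auto simp: path_image_def)
        then have "g u \<in> set es"
          using False neq u set_es by auto
        then obtain w where "w \<in> set ts" "g w = g u"
          by (auto simp: ts(3))
        then show ?thesis
          using le ts(2) by fastforce
      qed
      then obtain w where w: "0 \<le> w" "w \<le> t" "g w = g u"
        by blast
      have "g t = g w"
        using shortest_path_no_return[OF Ob g w(1,2) u(1,2)] w(3) endpoint_free[OF Ob u(3)] by simp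
      then show False
        using neq w(3) by simp
    qed
  qed (use t in auto)
  then show ?thesis
    using that t gt end_t endpoint_free[OF Ob] by auto
qed

text \<open>With no obstacle endpoint on the path other than its ends, \<open>s\<close> sees
  \<open>p\<close>; the chord is a lower bound for any path.\<close>

lemma kernel_region_dist:
  assumes Ob: "segment_obstacles Ob" and p: "p \<in> spm_region Ob s []"
  shows "obstacle_dist Ob s p = ereal (dist s p)"
proof -
  obtain g where g: "shortest_path Ob s p g" "passes_through Ob g []"
    using p by (auto simp: spm_region_def)
  then have av: "g \<in> avoiding_paths Ob s p" and len: "path_length g = obstacle_dist Ob s p"
    by (auto simp: shortest_path_def)
  then have g': "pathstart g = s" "pathfinish g = p" "g 0 = s" "g 1 = p"
    "s \<in> free_space Ob" "p \<in> free_space Ob"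
    by (auto simp: avoiding_paths_def obstacle_avoiding_def pathstart_def pathfinish_def)
  have "obstacle_endpoints Ob \<inter> path_image g \<subseteq> {s, p}"
    using g(2) unfolding passes_through_def g' by auto
  then have "visible Ob (g 0) p"
    using g' by (intro shortest_path_piece_visible[OF Ob g(1)]) (auto simp: path_image_def)
  then have "obstacle_dist Ob s p \<le> ereal (dist s p)"
    using obstacle_dist_le_route(2)[OF Ob, of s "[]" p] g' by simp
  moreover have "ereal (dist s p) \<le> obstacle_dist Ob s p"
    using dist_le_path_length[of 0 1 g] g' len by simp
  ultimately show ?thesis
    by (rule antisym)
qed

section \<open>Decomposition of the achievable region into circular regions\<close>

text \<open>A shortest path to \<open>p\<close> selects the region. There the distance from
  \<open>s\<close> is that of the control point plus a straight edge, so the length bound becomes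
  membership in a disk. The two inclusions use the two halves of \<open>obstacle_dist_via\<close>;
  \<open>kernel_region_dist\<close> covers the kernel.\<close>

theorem theorem8:
  fixes Ob :: "(point \<times> point) set" and s :: point and l :: real
  assumes "segment_obstacles Ob"
    and "s \<in> free_space Ob"
    and "l > 0"
  shows "achievable_region Ob s l =
           circular_kernel_region Ob s l \<union> \<Union> (circular_ordinary_regions Ob s l)"
proof (intro equalityI subsetI)
  note Ob = assms(1)
  fix p
  assume "p \<in> achievable_region Ob s l"
  then have dp: "obstacle_dist Ob s p \<le> ereal l"
    by (simp add: achievable_region_def)
  then have "avoiding_paths Ob s p \<noteq> {}"
    by (auto simp: obstacle_dist_def top_ereal_def)
  then obtain g where g: "shortest_path Ob s p g"
    using shortest_path_exists[OF Ob] by blast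
  then have av: "g \<in> avoiding_paths Ob s p" and len: "path_length g = obstacle_dist Ob s p"
    by (auto simp: shortest_path_def)
  obtain es where es: "passes_through Ob g es"
    using passes_through_exists[of Ob g] Ob by (auto simp: segment_obstacles_def)
  have p: "p \<in> spm_region Ob s es"
    using g es av by (auto simp: spm_region_def avoiding_paths_def obstacle_avoiding_def)
  show "p \<in> circular_kernel_region Ob s l \<union> \<Union> (circular_ordinary_regions Ob s l)"
  proof (cases "es = []")
    case True
    then show ?thesis
      using p kernel_region_dist[OF Ob, of p s] dp
      by (auto simp: circular_kernel_region_def kernel_region_def kernel_sequence_eq[OF assms(2)])
  next
    case False
    from control_point_time[OF Ob g es False] obtain t where
      t: "0 \<le> t" "t \<le> 1" "g t = control_point es" "g t \<in> free_space Ob" "g t \<noteq> p" .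
    obtain d where d: "obstacle_dist Ob s (control_point es) = ereal d"
      "ereal (d + dist (control_point es) p) \<le> path_length g"
      using obstacle_dist_via(1)[OF Ob av t(1,2,4)] t(3) by auto
    then have le: "d + dist (control_point es) p \<le> l"
      using dp len by (metis ereal_less_eq(3) order_trans)
    \<comment> \<open>\<open>p\<close> is the finish of the path and so never its own control point;
      this makes the bound on \<open>d\<close> strict, as validity requires.\<close>
    have "0 < dist (control_point es) p"
      using t by simp
    with le have "d < l"
      by linarith
    then have "valid_control_point Ob s l (control_point es)"
      using d(1) by (simp add: valid_control_point_def)
    moreover have "es \<in> ordinary_sequences Ob s"
      using p False
      by (auto simp: ordinary_sequences_def spm_sequences_def kernel_sequence_eq[OF assms(2)])
    moreover have "p \<in> circular_ordinary_region Ob s l es"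
      using p le d(1) by (simp add: circular_ordinary_region_def)
    ultimately show ?thesis
      by (auto simp: circular_ordinary_regions_def)
  qed
next
  note Ob = assms(1)
  fix p
  assume "p \<in> circular_kernel_region Ob s l \<union> \<Union> (circular_ordinary_regions Ob s l)"
  then consider "p \<in> circular_kernel_region Ob s l"
    | es where "es \<in> ordinary_sequences Ob s" "p \<in> circular_ordinary_region Ob s l es"
    by (auto simp: circular_ordinary_regions_def)
  then show "p \<in> achievable_region Ob s l"
  proof cases
    case 1
    then show ?thesis
      using kernel_region_dist[OF Ob, of p s]
      by (simp add: circular_kernel_region_def kernel_region_def kernel_sequence_eq[OF assms(2)]
          achievable_region_def)
  next
    case 2
    then have ne: "es \<noteq> []" and p: "p \<in> spm_region Ob s es"
      and le: "dist (control_point es) p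
        \<le> l - real_of_ereal (obstacle_dist Ob s (control_point es))"
      by (auto simp: ordinary_sequences_def kernel_sequence_eq[OF assms(2)]
          circular_ordinary_region_def)
    obtain g where g: "shortest_path Ob s p g" "passes_through Ob g es"
      using p by (auto simp: spm_region_def)
    then have av: "g \<in> avoiding_paths Ob s p"
      by (auto simp: shortest_path_def)
    from control_point_time[OF Ob g ne] obtain t where
      t: "0 \<le> t" "t \<le> 1" "g t = control_point es" "g t \<in> free_space Ob" "visible Ob (g t) p" .
    \<comment> \<open>Finiteness matters here: \<open>real_of_ereal\<close> would send an infinite
      distance to 0 and enlarge the disk.\<close>
    obtain d where d: "obstacle_dist Ob s (control_point es) = ereal d"
      using obstacle_dist_via(1)[OF Ob av t(1,2,4)] t(3) by auto
    have "obstacle_dist Ob s p \<le> ereal (d + dist (control_point es) p)"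
      using obstacle_dist_via(2)[OF Ob av t(1,2,4,5)] t(3) d by simp
    also have "\<dots> \<le> ereal l"
      using le d by simp
    finally show ?thesis
      by (simp add: achievable_region_def)
  qed
qed

end
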